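(* Let $\mathbb B$ be the open unit ball of a separable infinite-dimensional Hilbert space, let $\mathbb K$ be a regular unitarily invariant kernel on $\mathbb B$, let $N\ge1$, and let $\mathcal M$ be a nonzero submodule of $H_{\mathbb K}\otimes\mathbb C^N$. Then $\mathcal M$ is not essentially normal.
   Context: A regular unitarily invariant kernel on $\mathbb B$ is a reproducing kernel $\mathbb K(z,w)=\sum_{n\ge0}a_n\langle z,w\rangle^n$ with $a_0=1$, $a_n>0$ for all $n\ge1$, such that (I) there are $b_n\ge0$ ($n\ge1$) with $1-1/\mathbb K(z,w)=\sum_{n\ge1}b_n\langle z,w\rangle^n$; (II) $\lim_{n\to\infty}a_n/a_{n+1}=1$; (III) $\sum_{n\ge0}a_n=\infty$, i.e. $\sum_{n\ge1}b_n=1$. $H_{\mathbb K}$ is the associated reproducing kernel Hilbert space of holomorphic functions on $\mathbb B$. Fix an orthonormal basis of the underlying Hilbert space and let $z_1,z_2,\dots$ be the corresponding coordinate functions; the multiplication operators $M_{z_i}$ are bounded. A submodule of $H_{\mathbb K}\otimes\mathbb C^N$ is a closed subspace invariant under multiplication by polynomials in finitely many coordinates. Write $R_{z_i}=(M_{z_i}\otimes I)|_{\mathcal M}$. The submodule $\mathcal M$ is essentially normal if $R_{z_i}R_{z_i}^*-R_{z_i}^*R_{z_i}$ is compact for every $i\ge1$. *)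

theory Defs
  imports "HOL-Analysis.Analysis"
begin

text \<open>
  The complex inner product is linear in its first argument, so that
  \<open>\<langle>z, w\<rangle>\<close> is analytic in \<open>z\<close>.  The norm and the topology are those of the underlying
  \<^class>\<open>real_inner\<close> space, whose inner product is the real part of the complex one.
  Positive definiteness is inherited from \<^class>\<open>real_inner\<close>.
\<close>

class complex_hilbert = real_inner + complete_space +
  fixes scaleC :: "complex \<Rightarrow> 'a \<Rightarrow> 'a" (infixr \<open>*\<^sub>C\<close> 75)
    and cinner :: "'a \<Rightarrow> 'a \<Rightarrow> complex"
  assumes scaleC_add_right: "c *\<^sub>C (x + y) = c *\<^sub>C x + c *\<^sub>C y"
    and scaleC_add_left: "(c + d) *\<^sub>C x = c *\<^sub>C x + d *\<^sub>C x"
    and scaleC_scaleC: "c *\<^sub>C (d *\<^sub>C x) = (c * d) *\<^sub>C x"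
    and scaleR_conv_scaleC: "r *\<^sub>R x = complex_of_real r *\<^sub>C x"
    and cinner_commute: "cinner x y = cnj (cinner y x)"
    and cinner_add_left: "cinner (x + y) z = cinner x z + cinner y z"
    and cinner_scaleC_left: "cinner (c *\<^sub>C x) y = c * cinner x y"
    and inner_eq_Re_cinner: "inner x y = Re (cinner x y)"

interpretation complex_vector: vector_space
  "scaleC :: complex \<Rightarrow> 'a \<Rightarrow> 'a::complex_hilbert"
proof
  show "1 *\<^sub>C x = x" for x :: 'a
    using scaleR_conv_scaleC[of 1 x] by simp
qed (simp_all add: scaleC_add_right scaleC_add_left scaleC_scaleC)

text \<open>
  The type \<open>'h ^ 'n\<close> is the Hilbert space tensor product of \<open>'h\<close> with \<open>\<complex>\<^sup>N\<close>, where
  \<open>N = CARD('n)\<close>: the \<open>N\<close>-fold orthogonal direct sum of \<open>'h\<close>.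
\<close>

instantiation vec :: (complex_hilbert, finite) complex_hilbert
begin

definition scaleC_vec :: "complex \<Rightarrow> 'a ^ 'b \<Rightarrow> 'a ^ 'b" where
  "scaleC_vec c F = (\<chi> j. c *\<^sub>C (F $ j))"

definition cinner_vec :: "'a ^ 'b \<Rightarrow> 'a ^ 'b \<Rightarrow> complex" where
  "cinner_vec F G = (\<Sum>j\<in>UNIV. cinner (F $ j) (G $ j))"

instance
proof
  fix F G :: "'a ^ 'b"
  show "cinner F G = cnj (cinner G F)"
    unfolding cinner_vec_def cnj_sum by (rule sum.cong[OF refl], rule cinner_commute)
qed (simp_all add: scaleC_vec_def cinner_vec_def vec_eq_iff inner_vec_def scaleC_add_right
      scaleC_add_left scaleC_scaleC scaleR_conv_scaleC cinner_add_left cinner_scaleC_left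
      inner_eq_Re_cinner sum.distrib sum_distrib_left)

end

definition tensor_id :: "('h \<Rightarrow> 'h) \<Rightarrow> 'h ^ 'n \<Rightarrow> 'h ^ 'n" where
  "tensor_id T F = (\<chi> j. T (F $ j))"

text \<open>
  As the basis is indexed by \<^typ>\<open>nat\<close>, a space that has one is separable and
  infinite-dimensional; conversely every such complex Hilbert space has one.
\<close>

definition orthonormal_basis :: "(nat \<Rightarrow> 'e::complex_hilbert) \<Rightarrow> bool" where
  "orthonormal_basis e \<longleftrightarrow>
     (\<forall>i j. cinner (e i) (e j) = (if i = j then 1 else 0)) \<and>
     closure (complex_vector.span (range e)) = UNIV"

text \<open>
  Operators on a closed subspace \<open>M\<close> are represented by maps of the ambient space, of which only
  the values on \<open>M\<close> matter.  \<open>adjoint_on M T\<close> is the adjoint of \<open>T\<close> as an operator from \<open>M\<close>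
  to \<open>M\<close>; it is not the restriction of the adjoint on the ambient space.
\<close>

definition adjoint_on :: "'v::complex_hilbert set \<Rightarrow> ('v \<Rightarrow> 'v) \<Rightarrow> 'v \<Rightarrow> 'v" where
  "adjoint_on M T y = (THE v. v \<in> M \<and> (\<forall>x\<in>M. cinner (T x) y = cinner x v))"

definition compact_operator_on :: "'v::complex_hilbert set \<Rightarrow> ('v \<Rightarrow> 'v) \<Rightarrow> bool" where
  "compact_operator_on M T \<longleftrightarrow> (\<forall>S\<subseteq>M. bounded S \<longrightarrow> compact (closure (T ` S)))"

text \<open>
  Only the values of \<open>K\<close> on the open unit ball matter.  As \<open>1 / 0 = 0\<close> in HOL, the nonvanishing
  of \<open>K\<close> that the expression \<open>1 / K\<close> presupposes is stated explicitly.  Since the \<open>a n\<close> are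
  nonnegative, non-summability says that their sum is infinite.
\<close>

definition regular_unitarily_invariant_kernel ::
    "('e::complex_hilbert \<Rightarrow> 'e \<Rightarrow> complex) \<Rightarrow> bool" where
  "regular_unitarily_invariant_kernel K \<longleftrightarrow>
     (\<exists>a :: nat \<Rightarrow> real.
        a 0 = 1 \<and> (\<forall>n\<ge>1. a n > 0) \<and>
        (\<forall>z\<in>ball 0 1. \<forall>w\<in>ball 0 1. (\<lambda>n. complex_of_real (a n) * cinner z w ^ n) sums K z w) \<and>
        (\<exists>b :: nat \<Rightarrow> real. (\<forall>n\<ge>1. b n \<ge> 0) \<and>
           (\<forall>z\<in>ball 0 1. \<forall>w\<in>ball 0 1. K z w \<noteq> 0 \<and>
              (\<lambda>n. complex_of_real (b (Suc n)) * cinner z w ^ Suc n) sums (1 - 1 / K z w))) \<and>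
        ((\<lambda>n. a n / a (Suc n)) \<longlonglongrightarrow> 1) \<and>
        \<not> summable a)"

text \<open>
  The Hilbert space \<open>'h\<close> is the reproducing kernel Hilbert space on the set \<open>X\<close> with kernel \<open>K\<close>:
  the linear injective map \<open>ev\<close> identifies its elements with functions on \<open>X\<close>, the
  function \<open>K(\<cdot>, w)\<close> belongs to the space for every \<open>w \<in> X\<close>, and it reproduces the value at \<open>w\<close>.
  These properties determine the Hilbert space of functions from \<open>K\<close>.
  Values of \<open>ev\<close> and \<open>K\<close> off \<open>X\<close> are irrelevant.
\<close>

definition is_rkhs ::
    "'e set \<Rightarrow> ('e \<Rightarrow> 'e \<Rightarrow> complex) \<Rightarrow> ('h::complex_hilbert \<Rightarrow> 'e \<Rightarrow> complex) \<Rightarrow> bool" where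
  "is_rkhs X K ev \<longleftrightarrow>
     (\<forall>f g. \<forall>z\<in>X. ev (f + g) z = ev f z + ev g z) \<and>
     (\<forall>c f. \<forall>z\<in>X. ev (c *\<^sub>C f) z = c * ev f z) \<and>
     (\<forall>f g. (\<forall>z\<in>X. ev f z = ev g z) \<longrightarrow> f = g) \<and>
     (\<forall>w\<in>X. \<exists>k. (\<forall>z\<in>X. ev k z = K z w) \<and> (\<forall>f. ev f w = cinner f k))"

text \<open>
  Multiplication by \<open>\<phi>\<close>.  The product is again in the space when \<open>\<phi>\<close> is a polynomial in the
  coordinates and the kernel is regular, because multiplication by a coordinate is then a
  bounded operator; this is a consequence of regularity and not a further assumption.
\<close>

definition mult_op :: "'e set \<Rightarrow> ('h \<Rightarrow> 'e \<Rightarrow> complex) \<Rightarrow> ('e \<Rightarrow> complex) \<Rightarrow> 'h \<Rightarrow> 'h" where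
  "mult_op X ev \<phi> f = (THE g. \<forall>z\<in>X. ev g z = \<phi> z * ev f z)"

definition coord :: "(nat \<Rightarrow> 'e::complex_hilbert) \<Rightarrow> nat \<Rightarrow> 'e \<Rightarrow> complex" where
  "coord e i z = cinner z (e i)"

inductive_set coord_polynomials :: "(nat \<Rightarrow> 'e::complex_hilbert) \<Rightarrow> ('e \<Rightarrow> complex) set"
  for e where
    const: "(\<lambda>z. c) \<in> coord_polynomials e"
  | coord: "coord e i \<in> coord_polynomials e"
  | add: "p \<in> coord_polynomials e \<Longrightarrow> q \<in> coord_polynomials e \<Longrightarrow>
            (\<lambda>z. p z + q z) \<in> coord_polynomials e"
  | mult: "p \<in> coord_polynomials e \<Longrightarrow> q \<in> coord_polynomials e \<Longrightarrow>
            (\<lambda>z. p z * q z) \<in> coord_polynomials e"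

definition is_submodule ::
    "(nat \<Rightarrow> 'e::complex_hilbert) \<Rightarrow> ('h::complex_hilbert \<Rightarrow> 'e \<Rightarrow> complex) \<Rightarrow>
     ('h ^ 'n) set \<Rightarrow> bool" where
  "is_submodule e ev M \<longleftrightarrow>
     complex_vector.subspace M \<and> closed M \<and>
     (\<forall>p\<in>coord_polynomials e. \<forall>F\<in>M. tensor_id (mult_op (ball 0 1) ev p) F \<in> M)"

definition essentially_normal ::
    "(nat \<Rightarrow> 'e::complex_hilbert) \<Rightarrow> ('h::complex_hilbert \<Rightarrow> 'e \<Rightarrow> complex) \<Rightarrow>
     ('h ^ 'n) set \<Rightarrow> bool" where
  "essentially_normal e ev M \<longleftrightarrow>
     (\<forall>i. let R = tensor_id (mult_op (ball 0 1) ev (coord e i));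
              Rs = adjoint_on M R
          in compact_operator_on M (\<lambda>F. R (Rs F) - Rs (R F)))"

end

theory Submission
  imports Defs
begin

text \<open>
  Write \<open>z\<^sub>i\<close> for the \<open>i\<close>-th coordinate, \<open>T\<^sub>i\<close> for multiplication by it on the whole space, and \<open>R\<^sub>i\<close> for
  its restriction to the submodule \<open>M\<close>.  In infinitely many variables the coordinates that a given
  function hardly depends on act on it like creation operators: they
  are bounded below and have mutually orthogonal ranges.  This is incompatible with a compact
  self-commutator.

  The precise form of this is an identity (lemma \<open>cinner_T_T_hom\<close>).  Let
  \<open>h\<^sub>n\<^sub>,\<^sub>w\<close> be the homogeneous function \<open>z \<mapsto> \<langle>z, w\<rangle>\<^sup>n\<close>.  If \<open>w\<close> is orthogonal to the basis vector \<open>e\<^sub>i\<close>, then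
  \<open>T\<^sub>i\<^sup>* T\<^sub>j h\<^sub>n\<^sub>,\<^sub>w\<close> is \<open>0\<close> for \<open>j \<noteq> i\<close>, and it is \<open>c\<^sub>n h\<^sub>n\<^sub>,\<^sub>w\<close> with
  \<open>c\<^sub>n = a\<^sub>n / ((n + 1) a\<^sub>n\<^sub>+\<^sub>1) > 0\<close> for \<open>j = i\<close>.  The functions \<open>h\<^sub>n\<^sub>,\<^sub>w\<close> with \<open>w\<close> a finite combination of
  basis vectors span a dense subspace (lemma \<open>closure_poly_span\<close>), and each such \<open>w\<close>
  is orthogonal to almost all \<open>e\<^sub>i\<close>.

  Now fix a nonzero \<open>F \<in> M\<close> and put \<open>x\<^sub>j = z\<^sub>j F\<close>, a bounded sequence in \<open>M\<close>.

  \<^item> \<open>x\<^sub>j\<close> tends weakly to \<open>0\<close> (lemma \<open>weakly_null\<close>).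
  \<^item> Pick \<open>h\<^sub>n\<^sub>,\<^sub>w\<close> that is not orthogonal to some component \<open>f\<close> of \<open>F\<close>.  For all large distinct \<open>i\<close>, \<open>j\<close>,
    \<open>\<langle>T\<^sub>i T\<^sub>j f, T\<^sub>i T\<^sub>j h\<^sub>n\<^sub>,\<^sub>w\<rangle> = c\<^sub>n c\<^sub>n\<^sub>+\<^sub>1 \<langle>f, h\<^sub>n\<^sub>,\<^sub>w\<rangle>\<close>, and as the \<open>T\<^sub>i\<close> are uniformly bounded,
    \<open>\<parallel>R\<^sub>i x\<^sub>j\<parallel> \<ge> \<delta>\<close> with a \<open>\<delta> > 0\<close> independent of \<open>i\<close> and \<open>j\<close> (lemma \<open>R_R_bounded_below\<close>).
  \<^item> Approximating \<open>F\<close> by combinations of the \<open>h\<^sub>n\<^sub>,\<^sub>w\<close> shows that, for \<open>i\<close> large and every \<open>j \<noteq> i\<close>, \<open>x\<^sub>j\<close> is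
    nearly orthogonal to the range of \<open>R\<^sub>i\<close>; hence \<open>\<parallel>R\<^sub>i\<^sup>* x\<^sub>j\<parallel> \<le> \<delta> / 2\<close> (lemma \<open>R_R_nearly_orthogonal\<close>).

  Fix such an \<open>i\<close> and let \<open>A = R\<^sub>i R\<^sub>i\<^sup>* - R\<^sub>i\<^sup>* R\<^sub>i\<close>.  Then
  \<open>\<bar>\<langle>A x\<^sub>j, x\<^sub>j\<rangle>\<bar> = \<bar>\<parallel>R\<^sub>i\<^sup>* x\<^sub>j\<parallel>\<^sup>2 - \<parallel>R\<^sub>i x\<^sub>j\<parallel>\<^sup>2\<bar> \<ge> \<delta>\<^sup>2 / 2\<close> for all large \<open>j\<close>, whereas a compact \<open>A\<close> would make
  \<open>\<langle>A x\<^sub>j, x\<^sub>j\<rangle>\<close> tend to \<open>0\<close> along a subsequence.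

  The coefficients of a homogeneous expansion are extracted throughout by averaging over roots of
  unity; this yields the functions \<open>h\<^sub>n\<^sub>,\<^sub>w\<close> from the kernel functions, and \<open>z\<^sub>i h\<^sub>n\<^sub>,\<^sub>w\<close> from the
  functions \<open>h\<^sub>n\<^sub>+\<^sub>1\<^sub>,\<^sub>v\<close>, together with all inner products that are needed.
\<close>

section \<open>Complex Hilbert spaces\<close>

lemma cinner_zero_left [simp]: "cinner 0 (y :: 'a::complex_hilbert) = 0"
  using cinner_add_left[of 0 0 y] by simp

lemma cinner_zero_right [simp]: "cinner (y :: 'a::complex_hilbert) 0 = 0"
  using cinner_commute[of y 0] by simp

lemma cinner_add_right: "cinner x (y + z) = cinner x y + cinner (x :: 'a::complex_hilbert) z"
  by (metis cinner_add_left cinner_commute complex_cnj_add)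

lemma cinner_scaleC_right: "cinner x (c *\<^sub>C y) = cnj c * cinner (x :: 'a::complex_hilbert) y"
  by (metis cinner_scaleC_left cinner_commute complex_cnj_mult)

lemma cinner_minus_left: "cinner (- x) y = - cinner (x :: 'a::complex_hilbert) y"
  using cinner_add_left[of x "- x" y] by (simp add: add_eq_0_iff)

lemma cinner_diff_left: "cinner (x - y) z = cinner x z - cinner (y :: 'a::complex_hilbert) z"
  using cinner_add_left[of x "- y" z] by (simp add: cinner_minus_left)

lemma cinner_diff_right: "cinner x (y - z) = cinner x y - cinner (x :: 'a::complex_hilbert) z"
  by (metis cinner_diff_left cinner_commute complex_cnj_diff)

lemma cinner_sum_left: "cinner (sum f A) y = (\<Sum>i\<in>A. cinner (f i) (y :: 'a::complex_hilbert))"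
  by (induction A rule: infinite_finite_induct) (auto simp: cinner_add_left)

lemma cinner_sum_right: "cinner y (sum f A) = (\<Sum>i\<in>A. cinner (y :: 'a::complex_hilbert) (f i))"
  by (induction A rule: infinite_finite_induct) (auto simp: cinner_add_right)

lemma cinner_self: "cinner x x = complex_of_real ((norm (x :: 'a::complex_hilbert))\<^sup>2)"
proof -
  have "Im (cinner x x) = 0"
    using arg_cong[OF cinner_commute[of x x], of Im] by simp
  then show ?thesis
    by (simp add: complex_eq_iff power2_norm_eq_inner inner_eq_Re_cinner)
qed

lemma norm_scaleC: "norm (c *\<^sub>C x) = cmod c * norm (x :: 'a::complex_hilbert)"
proof -
  have "complex_of_real ((norm (c *\<^sub>C x))\<^sup>2) = c * cnj c * complex_of_real ((norm x)\<^sup>2)"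
    unfolding cinner_self[symmetric] by (simp add: cinner_scaleC_left cinner_scaleC_right)
  also have "\<dots> = complex_of_real ((cmod c * norm x)\<^sup>2)"
    unfolding complex_norm_square[symmetric] of_real_mult[symmetric] power_mult_distrib by (rule refl)
  finally have "(norm (c *\<^sub>C x))\<^sup>2 = (cmod c * norm x)\<^sup>2"
    using of_real_eq_iff by blast
  then show ?thesis by (simp add: power2_eq_iff_nonneg)
qed

lemma norm_cinner_le: "cmod (cinner x y) \<le> norm x * norm (y :: 'a::complex_hilbert)"
proof (cases "cinner x y = 0")
  case False
  define u where "u = cnj (cinner x y) / cmod (cinner x y)"
  have u: "cmod u = 1" using False by (simp add: u_def norm_divide)
  have "cinner (u *\<^sub>C x) y = complex_of_real (cmod (cinner x y))"
    using False
    by (simp add: u_def cinner_scaleC_left complex_norm_square[symmetric] power2_eq_square mult.commute)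
  then have "cmod (cinner x y) = inner (u *\<^sub>C x) y"
    by (simp add: inner_eq_Re_cinner)
  also have "\<dots> \<le> norm (u *\<^sub>C x) * norm y" by (rule norm_cauchy_schwarz)
  finally show ?thesis by (simp add: norm_scaleC u)
qed simp

lemma bounded_linear_cinner_left: "bounded_linear (\<lambda>x. cinner x (y :: 'a::complex_hilbert))"
proof (rule bounded_linear_intro[of _ "norm y"])
  show "cinner (r *\<^sub>R x) y = r *\<^sub>R cinner x y" for r x
    by (simp only: scaleR_conv_scaleC cinner_scaleC_left scaleR_conv_of_real)
qed (rule cinner_add_left norm_cinner_le)+

lemma bounded_linear_cinner_right: "bounded_linear (\<lambda>x. cinner (y :: 'a::complex_hilbert) x)"
proof (rule bounded_linear_intro[of _ "norm y"])
  show "cinner y (r *\<^sub>R x) = r *\<^sub>R cinner y x" for r x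
    by (simp only: scaleR_conv_scaleC cinner_scaleC_right scaleR_conv_of_real complex_cnj_complex_of_real)
  show "norm (cinner y x) \<le> norm x * norm y" for x
    using norm_cinner_le[of y x] by (simp only: mult.commute)
qed (rule cinner_add_right)

lemmas tendsto_cinner_left = bounded_linear.tendsto[OF bounded_linear_cinner_left]
lemmas tendsto_cinner_right = bounded_linear.tendsto[OF bounded_linear_cinner_right]

lemma bounded_linear_scaleC: "bounded_linear (\<lambda>x. c *\<^sub>C (x :: 'a::complex_hilbert))"
proof (rule bounded_linear_intro[of _ "cmod c"])
  show "c *\<^sub>C r *\<^sub>R x = r *\<^sub>R c *\<^sub>C x" for r and x :: 'a
    by (simp only: scaleR_conv_scaleC scaleC_scaleC mult.commute)
  show "norm (c *\<^sub>C x) \<le> norm x * cmod c" for x :: 'a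
    by (simp only: norm_scaleC mult.commute)
qed (rule scaleC_add_right)

lemma subspace_closure:
  assumes "complex_vector.subspace (S :: 'a::complex_hilbert set)"
  shows "complex_vector.subspace (closure S)"
proof (rule complex_vector.subspaceI)
  show "0 \<in> closure S"
    using complex_vector.subspace_0[OF assms] closure_subset by blast
next
  fix x y assume "x \<in> closure S" "y \<in> closure S"
  then obtain f g where f: "\<forall>n. f n \<in> S" "f \<longlonglongrightarrow> x" and g: "\<forall>n. g n \<in> S" "g \<longlonglongrightarrow> y"
    unfolding closure_sequential by blast
  show "x + y \<in> closure S"
    unfolding closure_sequential
    by (intro CollectI exI[of _ "\<lambda>n. f n + g n"] conjI allI tendsto_add f(2) g(2))
      (intro complex_vector.subspace_add[OF assms] f(1)[rule_format] g(1)[rule_format])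
next
  fix c x assume "x \<in> closure S"
  then obtain f where f: "\<forall>n. f n \<in> S" "f \<longlonglongrightarrow> x"
    unfolding closure_sequential by blast
  show "c *\<^sub>C x \<in> closure S"
    unfolding closure_sequential
    by (intro CollectI exI[of _ "\<lambda>n. c *\<^sub>C f n"] conjI allI bounded_linear.tendsto[OF bounded_linear_scaleC f(2)])
      (intro complex_vector.subspace_scale[OF assms] f(1)[rule_format])
qed

text \<open>
  The representing vector is the minimiser of \<open>\<parallel>x\<parallel>\<^sup>2 - 2 Re (\<phi> x)\<close> over the subspace.  A minimising
  sequence is Cauchy by the parallelogram law, and the first-order condition at the minimum
  identifies the real part of \<open>\<phi>\<close>; replacing \<open>x\<close> by \<open>\<i> x\<close> gives the imaginary part.
\<close>

lemma Riesz_representation_on_subspace: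
  fixes \<phi> :: "'a::complex_hilbert \<Rightarrow> complex"
  assumes S: "complex_vector.subspace S" "closed S"
    and add: "\<And>x y. x \<in> S \<Longrightarrow> y \<in> S \<Longrightarrow> \<phi> (x + y) = \<phi> x + \<phi> y"
    and scale: "\<And>c x. x \<in> S \<Longrightarrow> \<phi> (c *\<^sub>C x) = c * \<phi> x"
    and bound: "\<And>x. x \<in> S \<Longrightarrow> cmod (\<phi> x) \<le> B * norm x"
  obtains v where "v \<in> S" "\<And>x. x \<in> S \<Longrightarrow> \<phi> x = cinner x v"
proof -
  define J where "J x = (norm x)\<^sup>2 - 2 * Re (\<phi> x)" for x
  have scaleR: "r *\<^sub>R x \<in> S" "Re (\<phi> (r *\<^sub>R x)) = r * Re (\<phi> x)" if "x \<in> S" for r x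
    using that complex_vector.subspace_scale[OF S(1)] by (auto simp: scaleR_conv_scaleC scale)
  have lower: "- B\<^sup>2 \<le> J x" if "x \<in> S" for x
  proof -
    have "Re (\<phi> x) \<le> B * norm x"
      using bound[OF that] complex_Re_le_cmod[of "\<phi> x"] by linarith
    moreover have "0 \<le> (norm x - B)\<^sup>2" by simp
    ultimately show ?thesis unfolding J_def power2_diff by (simp add: mult.commute)
  qed
  define m where "m = Inf (J ` S)"
  have bdd: "bdd_below (J ` S)" using lower by (intro bdd_belowI[of _ "- B\<^sup>2"]) auto
  have ne: "J ` S \<noteq> {}" using complex_vector.subspace_0[OF S(1)] by auto
  have m_le: "m \<le> J x" if "x \<in> S" for x
    unfolding m_def using bdd that by (intro cInf_lower) auto
  have "\<exists>x\<in>S. J x < m + 1 / real (Suc k)" for k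
    using cInf_lessD[OF ne, of "m + 1 / real (Suc k)"] unfolding m_def[symmetric] by auto
  then obtain x where x: "\<And>k. x k \<in> S" "\<And>k. J (x k) < m + 1 / real (Suc k)" by metis
  have par: "(norm (x k - x l))\<^sup>2 \<le> 2 * (J (x k) + J (x l) - 2 * m)" for k l
  proof -
    let ?y = "(1/2) *\<^sub>R (x k + x l)"
    have sum: "x k + x l \<in> S" using x(1) complex_vector.subspace_add[OF S(1)] by blast
    have "m \<le> J ?y" by (intro m_le scaleR(1) sum)
    moreover have "Re (\<phi> ?y) = (Re (\<phi> (x k)) + Re (\<phi> (x l))) / 2"
      by (subst scaleR(2)[OF sum]) (simp add: add x(1))
    moreover have "(norm ?y)\<^sup>2 = (norm (x k + x l))\<^sup>2 / 4"
      by (simp add: power_mult_distrib power2_eq_square)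
    moreover have "(norm (x k + x l))\<^sup>2 + (norm (x k - x l))\<^sup>2 = 2 * (norm (x k))\<^sup>2 + 2 * (norm (x l))\<^sup>2"
      by (simp add: power2_norm_eq_inner algebra_simps inner_commute)
    ultimately show ?thesis unfolding J_def by argo
  qed
  have "Cauchy x"
  proof (rule metric_CauchyI)
    fix \<epsilon> :: real assume "\<epsilon> > 0"
    then obtain n where n: "1 / real (Suc n) < \<epsilon>\<^sup>2 / 4"
      using nat_approx_posE[of "\<epsilon>\<^sup>2 / 4"] by (metis zero_less_divide_iff zero_less_numeral zero_less_power)
    have "dist (x k) (x l) < \<epsilon>" if "k \<ge> n" "l \<ge> n" for k l
    proof -
      have "1 / real (Suc k) \<le> 1 / real (Suc n)" "1 / real (Suc l) \<le> 1 / real (Suc n)"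
        using that by (auto intro!: divide_left_mono)
      then have "(norm (x k - x l))\<^sup>2 < \<epsilon>\<^sup>2"
        using par[of k l] x(2)[of k] x(2)[of l] n by argo
      then show ?thesis
        using \<open>\<epsilon> > 0\<close> by (simp add: dist_norm power_less_imp_less_base)
    qed
    then show "\<exists>M. \<forall>m\<ge>M. \<forall>n\<ge>M. dist (x m) (x n) < \<epsilon>" by blast
  qed
  then obtain v where v: "x \<longlonglongrightarrow> v" using Cauchy_convergent_iff convergent_def by blast
  have vS: "v \<in> S" using closed_sequentially[OF S(2)] x(1) v by blast
  have diff: "u - v \<in> S" if "u \<in> S" for u
    using that vS complex_vector.subspace_diff[OF S(1)] by blast
  have "(\<lambda>k. \<phi> (x k)) \<longlonglongrightarrow> \<phi> v"
  proof (rule Lim_null[THEN iffD2], rule Lim_null_comparison)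
    have "\<phi> (x k) - \<phi> v = \<phi> (x k - v)" for k
      using add[OF diff[OF x(1)[of k]] vS] by simp
    then show "\<forall>\<^sub>F k in sequentially. norm (\<phi> (x k) - \<phi> v) \<le> B * norm (x k - v)"
      using bound[OF diff[OF x(1)]] by simp
    show "(\<lambda>k. B * norm (x k - v)) \<longlonglongrightarrow> 0"
      using v by (intro tendsto_mult_right_zero tendsto_norm_zero) (simp add: Lim_null[symmetric])
  qed
  then have "(\<lambda>k. J (x k)) \<longlonglongrightarrow> J v"
    unfolding J_def using v by (intro tendsto_intros)
  moreover have "(\<lambda>k. m + 1 / real (Suc k)) \<longlonglongrightarrow> m + 0"
    by (intro tendsto_add tendsto_const) (use LIMSEQ_inverse_real_of_nat in \<open>simp add: inverse_eq_divide\<close>)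
  ultimately have Jv: "J v \<le> m"
    using x(2) by (intro LIMSEQ_le[of "\<lambda>k. J (x k)" _ "\<lambda>k. m + 1 / real (Suc k)"]) (auto intro: less_imp_le)
  have re: "Re (\<phi> u) = inner u v" if u: "u \<in> S" for u
  proof (rule ccontr)
    assume ne: "Re (\<phi> u) \<noteq> inner u v"
    define d where "d = Re (\<phi> u) - inner u v"
    \<comment> \<open>almost the minimiser of \<open>t \<mapsto> J (v + t u)\<close>; the \<open>+ 1\<close> avoids a separate case \<open>u = 0\<close>\<close>
    define t where "t = d / ((norm u)\<^sup>2 + 1)"
    have pos: "(norm u)\<^sup>2 + 1 > 0" by (simp add: add_nonneg_pos)
    have le: "J v \<le> J (v + t *\<^sub>R u)"
      using Jv m_le[of "v + t *\<^sub>R u"] vS scaleR(1)[OF u] complex_vector.subspace_add[OF S(1)]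
      by fastforce
    have "(norm (v + t *\<^sub>R u))\<^sup>2 = (norm v)\<^sup>2 + 2 * t * inner u v + t\<^sup>2 * (norm u)\<^sup>2"
      unfolding power2_norm_eq_inner
      by (simp add: inner_add_left inner_add_right inner_commute[of v u] power2_eq_square algebra_simps)
    then have "J (v + t *\<^sub>R u) = J v - 2 * t * d + t\<^sup>2 * (norm u)\<^sup>2"
      using add[OF vS scaleR(1)[OF u]] scaleR(2)[OF u]
      unfolding J_def d_def
      by (simp add: algebra_simps)
    with le have "2 * t * d \<le> t\<^sup>2 * (norm u)\<^sup>2" by simp
    also have "\<dots> \<le> t\<^sup>2 * ((norm u)\<^sup>2 + 1)" by (simp add: algebra_simps)
    also have "\<dots> = t * d" unfolding t_def using pos by (simp add: power2_eq_square)
    finally have "t * d \<le> 0" by linarith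
    moreover have "t * d = d\<^sup>2 / ((norm u)\<^sup>2 + 1)" unfolding t_def by (simp add: power2_eq_square)
    moreover have "d\<^sup>2 / ((norm u)\<^sup>2 + 1) > 0" using ne pos unfolding d_def by simp
    ultimately show False by simp
  qed
  have "\<phi> u = cinner u v" if u: "u \<in> S" for u
  proof (rule complex_eqI)
    show "Re (\<phi> u) = Re (cinner u v)" using re[OF u] by (simp add: inner_eq_Re_cinner)
    have "\<i> *\<^sub>C u \<in> S" using u complex_vector.subspace_scale[OF S(1)] by blast
    from re[OF this] show "Im (\<phi> u) = Im (cinner u v)"
      by (simp add: scale[OF u] inner_eq_Re_cinner cinner_scaleC_left)
  qed
  with vS that show ?thesis by blast
qed

text \<open>
  The definite description in the definition of \<open>adjoint_on\<close> has a value: existence is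
  Riesz representation on \<open>M\<close>, uniqueness is clear because the difference of two candidates lies in \<open>M\<close>.
\<close>

lemma adjoint_on_characterization:
  fixes T :: "'v::complex_hilbert \<Rightarrow> 'v"
  assumes M: "complex_vector.subspace M" "closed M"
    and T: "bounded_linear T" "\<And>c x. T (c *\<^sub>C x) = c *\<^sub>C T x"
  shows "adjoint_on M T y \<in> M \<and> (\<forall>x\<in>M. cinner (T x) y = cinner x (adjoint_on M T y))"
proof -
  interpret T: bounded_linear T by fact
  obtain B where B: "\<And>x. norm (T x) \<le> norm x * B" using T.bounded by blast
  obtain v where v: "v \<in> M" "\<And>x. x \<in> M \<Longrightarrow> cinner (T x) y = cinner x v"
  proof (rule Riesz_representation_on_subspace[OF M, of "\<lambda>x. cinner (T x) y" "B * norm y"])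
    show "cmod (cinner (T x) y) \<le> B * norm y * norm x" for x
      using norm_cinner_le[of "T x" y] mult_right_mono[OF B[of x], of "norm y"] by (simp add: mult_ac)
  qed (auto simp: T.add T(2) cinner_add_left cinner_scaleC_left)
  have "u = v" if u: "u \<in> M \<and> (\<forall>x\<in>M. cinner (T x) y = cinner x u)" for u
  proof -
    have d: "u - v \<in> M" using u v(1) complex_vector.subspace_diff[OF M(1)] by blast
    then have "cinner (u - v) (u - v) = 0"
      using u v(2)[OF d] by (simp add: cinner_diff_right)
    then show ?thesis by (simp add: cinner_self)
  qed
  then have "adjoint_on M T y = v"
    unfolding adjoint_on_def using v by (intro the_equality) auto
  with v show ?thesis by simp
qed

text \<open>
  Representing \<open>\<langle>\<cdot>, f\<rangle>\<close> on the closure of \<open>S\<close> by a vector \<open>v\<close> of it amounts to the orthogonal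
  projection of \<open>f\<close>; here \<open>f - v\<close> is orthogonal to \<open>S\<close>.
\<close>

lemma dense_if_orthogonal_trivial:
  fixes S :: "'a::complex_hilbert set"
  assumes S: "complex_vector.subspace S"
    and triv: "\<And>f. (\<And>x. x \<in> S \<Longrightarrow> cinner x f = 0) \<Longrightarrow> f = 0"
  shows "closure S = UNIV"
proof -
  have "f \<in> closure S" for f
  proof -
    obtain v where v: "v \<in> closure S" "\<And>x. x \<in> closure S \<Longrightarrow> cinner x f = cinner x v"
      by (rule Riesz_representation_on_subspace[OF subspace_closure[OF S] closed_closure,
            of "\<lambda>x. cinner x f" "norm f"])
        (use norm_cinner_le[of _ f] in \<open>auto simp: cinner_add_left cinner_scaleC_left ac_simps\<close>)
    have "f - v = 0"
      using v(2) closure_subset[of S] by (intro triv) (simp add: cinner_diff_right subset_eq)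
    then show ?thesis using v(1) by simp
  qed
  then show ?thesis by blast
qed

text \<open>
  Expanding the square, \<open>\<parallel>x\<^sub>k - x\<^sub>l\<parallel>\<^sup>2\<close> is a signed sum of four Gram entries whose limits cancel.
\<close>

lemma Cauchy_if_cinner_convergent:
  fixes x :: "nat \<Rightarrow> 'a::complex_hilbert"
  assumes lim: "\<And>k l. N \<le> k \<Longrightarrow> N \<le> l \<Longrightarrow> cmod (cinner (x k) (x l) - A) \<le> t k"
    and t: "t \<longlonglongrightarrow> 0"
  shows "Cauchy x"
proof (rule metric_CauchyI)
  fix \<epsilon> :: real assume "\<epsilon> > 0"
  then have "\<epsilon>\<^sup>2 / 4 > 0" by simp
  from LIMSEQ_D[OF t this] obtain n where "\<forall>k\<ge>n. norm (t k - 0) < \<epsilon>\<^sup>2 / 4" by blast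
  then have n: "\<bar>t k\<bar> < \<epsilon>\<^sup>2 / 4" if "k \<ge> n" for k using that by simp
  have "dist (x k) (x l) < \<epsilon>" if "k \<ge> max n N" "l \<ge> max n N" for k l
  proof -
    let ?c = "\<lambda>k l. cinner (x k) (x l) - A"
    have "complex_of_real ((norm (x k - x l))\<^sup>2) = ?c k k - ?c k l - ?c l k + ?c l l"
      unfolding cinner_self[symmetric] by (simp add: cinner_diff_left cinner_diff_right)
    then have "(norm (x k - x l))\<^sup>2 = cmod (?c k k - ?c k l - ?c l k + ?c l l)"
      using norm_of_real[of "(norm (x k - x l))\<^sup>2", where ?'a = complex] by simp
    also have "\<dots> \<le> cmod (?c k k) + cmod (?c k l) + cmod (?c l k) + cmod (?c l l)"
      using norm_triangle_ineq[of "?c k k - ?c k l - ?c l k" "?c l l"]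
        norm_triangle_ineq4[of "?c k k - ?c k l" "?c l k"] norm_triangle_ineq4[of "?c k k" "?c k l"]
      by linarith
    also have "\<dots> \<le> t k + t k + t l + t l"
      using that by (intro add_mono lim) auto
    also have "\<dots> < \<epsilon>\<^sup>2" using n[of k] n[of l] that by auto
    finally show ?thesis
      using \<open>\<epsilon> > 0\<close> by (simp add: dist_norm power_less_imp_less_base)
  qed
  then show "\<exists>M. \<forall>m\<ge>M. \<forall>n\<ge>M. dist (x m) (x n) < \<epsilon>" by blast
qed

section \<open>Extracting coefficients by averaging over roots of unity\<close>

definition unity_root :: "nat \<Rightarrow> nat \<Rightarrow> complex" where
  "unity_root L r = cis (2 * pi * real r / real L)"

text \<open>
  The discrete Fourier coefficient that isolates the term \<open>c (cnj \<mu>)\<^sup>n\<close> of a function of a unimodular \<open>\<mu>\<close>.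
  Conjugate powers are the natural ones here, because the
  kernel \<open>\<langle>z, \<mu> w\<rangle>\<close> is antilinear in \<open>\<mu>\<close>.
\<close>

definition coeff_avg :: "nat \<Rightarrow> nat \<Rightarrow> (complex \<Rightarrow> complex) \<Rightarrow> complex" where
  "coeff_avg L n g = (\<Sum>r<L. unity_root L r ^ n * g (unity_root L r)) / of_nat L"

lemma norm_unity_root [simp]: "cmod (unity_root L r) = 1"
  by (simp add: unity_root_def)

lemma coeff_avg_add: "coeff_avg L n (\<lambda>\<mu>. f \<mu> + g \<mu>) = coeff_avg L n f + coeff_avg L n g"
  by (simp add: coeff_avg_def distrib_left sum.distrib add_divide_distrib)

lemma coeff_avg_diff: "coeff_avg L n (\<lambda>\<mu>. f \<mu> - g \<mu>) = coeff_avg L n f - coeff_avg L n g"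
  by (simp add: coeff_avg_def right_diff_distrib sum_subtractf diff_divide_distrib)

lemma coeff_avg_sum: "coeff_avg L n (\<lambda>\<mu>. \<Sum>i\<in>I. f i \<mu>) = (\<Sum>i\<in>I. coeff_avg L n (f i))"
proof -
  have "(\<Sum>r<L. unity_root L r ^ n * (\<Sum>i\<in>I. f i (unity_root L r)))
      = (\<Sum>i\<in>I. \<Sum>r<L. unity_root L r ^ n * f i (unity_root L r))"
    unfolding sum_distrib_left by (rule sum.swap)
  then show ?thesis by (simp add: coeff_avg_def sum_divide_distrib)
qed

lemma coeff_avg_mult_left: "coeff_avg L n (\<lambda>\<mu>. c * g \<mu>) = c * coeff_avg L n g"
  by (simp add: coeff_avg_def sum_distrib_left mult.left_commute)

lemma coeff_avg_mult_right: "coeff_avg L n (\<lambda>\<mu>. g \<mu> * c) = coeff_avg L n g * c"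
  using coeff_avg_mult_left[of L n c g] by (simp add: mult.commute)

lemma coeff_avg_cong:
  assumes "\<And>\<mu>. cmod \<mu> = 1 \<Longrightarrow> f \<mu> = g \<mu>"
  shows "coeff_avg L n f = coeff_avg L n g"
  by (simp add: coeff_avg_def assms)

lemma coeff_avg_monomial:
  assumes "m < L" "n < L"
  shows "coeff_avg L n (\<lambda>\<mu>. c * cnj \<mu> ^ m) = (if m = n then c else 0)"
proof -
  define \<zeta> where "\<zeta> = unity_root L n * cnj (unity_root L m)"
  have L: "L > 0" using assms by simp
  have pow: "unity_root L r ^ k = unity_root L k ^ r" for r k
    by (simp add: unity_root_def Complex.DeMoivre mult_ac)
  have cnj: "unity_root L k * cnj (unity_root L k) = 1" for k
    by (simp add: complex_norm_square[symmetric])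
  have "unity_root L r ^ n * (c * cnj (unity_root L r) ^ m) = c * \<zeta> ^ r" for r
    unfolding \<zeta>_def power_mult_distrib complex_cnj_power[symmetric] pow[of r] by (simp add: mult_ac)
  then have eq: "coeff_avg L n (\<lambda>\<mu>. c * cnj \<mu> ^ m) = c * (\<Sum>r<L. \<zeta> ^ r) / of_nat L"
    by (simp only: coeff_avg_def sum_distrib_left)
  show ?thesis
  proof (cases "m = n")
    case True
    then have "\<zeta> = 1" by (simp add: \<zeta>_def cnj)
    with True L show ?thesis unfolding eq by simp
  next
    case False
    have "unity_root L k ^ L = 1" for k
    proof -
      have "real L * (2 * pi * real k / real L) = 2 * pi * real k" using L by simp
      then show ?thesis by (simp only: unity_root_def Complex.DeMoivre cis_multiple_2pi Ints_of_nat)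
    qed
    then have "\<zeta> ^ L = 1"
      by (simp add: \<zeta>_def power_mult_distrib flip: complex_cnj_power)
    moreover have "\<zeta> \<noteq> 1"
    proof
      assume "\<zeta> = 1"
      then have "unity_root L n * (unity_root L m * cnj (unity_root L m)) = unity_root L m" by (simp add: \<zeta>_def mult_ac)
      then have "unity_root L n = unity_root L m" by (simp add: cnj)
      then show False
        using Complex.bij_betw_roots_unity[OF L] False assms
        unfolding unity_root_def bij_betw_def inj_on_def by blast
    qed
    ultimately show ?thesis using False by (simp add: eq sum_gp_strict)
  qed
qed

lemma coeff_avg_bound:
  assumes "L > 0" "\<And>\<mu>. cmod \<mu> = 1 \<Longrightarrow> cmod (g \<mu>) \<le> B"
  shows "cmod (coeff_avg L n g) \<le> B"
proof -
  have "cmod (\<Sum>r<L. unity_root L r ^ n * g (unity_root L r)) \<le> (\<Sum>r<L. B)"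
    by (intro sum_norm_le) (simp add: norm_mult norm_power assms(2))
  then show ?thesis
    using assms(1) by (simp add: coeff_avg_def norm_divide divide_le_eq mult.commute)
qed

text \<open>
  The average with \<open>L\<close>-th roots of unity recovers the coefficient of every polynomial of degree below
  \<open>L\<close> exactly, so the error comes from the tail of the series only.
\<close>

lemma coeff_avg_power_series:
  assumes "n < L" and sum: "summable (\<lambda>m. cmod (c m))"
    and g: "\<And>\<mu>. cmod \<mu> = 1 \<Longrightarrow> (\<lambda>m. c m * cnj \<mu> ^ m) sums g \<mu>"
  shows "cmod (coeff_avg L n g - c n) \<le> (\<Sum>m. cmod (c (m + L)))"
proof -
  define p where "p \<mu> = (\<Sum>m<L. c m * cnj \<mu> ^ m)" for \<mu>
  have "coeff_avg L n p = (\<Sum>m<L. if m = n then c m else 0)"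
    unfolding p_def coeff_avg_sum by (intro sum.cong refl coeff_avg_monomial) (use \<open>n < L\<close> in auto)
  then have p: "coeff_avg L n p = c n" using \<open>n < L\<close> by simp
  have sum': "summable (\<lambda>m. cmod (c (m + L)))"
    using summable_ignore_initial_segment[OF sum] .
  have "cmod (g \<mu> - p \<mu>) \<le> (\<Sum>m. cmod (c (m + L)))" if \<mu>: "cmod \<mu> = 1" for \<mu>
  proof -
    have "(\<lambda>m. c (m + L) * cnj \<mu> ^ (m + L)) sums (g \<mu> - p \<mu>)"
      using g[OF \<mu>] unfolding p_def by (subst sums_iff_shift) simp
    then have "g \<mu> - p \<mu> = (\<Sum>m. c (m + L) * cnj \<mu> ^ (m + L))" by (simp add: sums_iff)
    moreover have "cmod (\<Sum>m. c (m + L) * cnj \<mu> ^ (m + L)) \<le> (\<Sum>m. cmod (c (m + L)))"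
      by (rule norm_suminf_le) (use sum' \<mu> in \<open>auto simp: norm_mult norm_power\<close>)
    ultimately show ?thesis by simp
  qed
  then have "cmod (coeff_avg L n (\<lambda>\<mu>. g \<mu> - p \<mu>)) \<le> (\<Sum>m. cmod (c (m + L)))"
    using \<open>n < L\<close> by (intro coeff_avg_bound) auto
  then show ?thesis by (simp add: coeff_avg_diff p)
qed

text \<open>
  By the binomial theorem the coefficient of \<open>cnj \<mu>\<close> is \<open>(n + 1) A\<^sup>n B\<close>; the number \<open>n + 2\<close> of roots
  exceeds the degree, which makes the extraction exact.
\<close>

lemma coeff_avg_affine_power:
  "coeff_avg (Suc (Suc n)) 1 (\<lambda>\<mu>. (A + cnj \<mu> * B) ^ Suc n) = of_nat (Suc n) * A ^ n * B"
proof -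
  let ?N = "Suc n"
  let ?c = "\<lambda>k. of_nat (?N choose k) * B ^ k * A ^ (?N - k)"
  have "(\<lambda>\<mu>. (A + cnj \<mu> * B) ^ ?N) = (\<lambda>\<mu>. \<Sum>k\<le>?N. ?c k * cnj \<mu> ^ k)"
    by (subst add.commute, subst binomial_ring)
      (intro ext sum.cong refl, simp add: power_mult_distrib mult_ac)
  moreover have "coeff_avg (Suc ?N) 1 (\<lambda>\<mu>. \<Sum>k\<le>?N. ?c k * cnj \<mu> ^ k) = (\<Sum>k\<le>?N. if k = 1 then ?c k else 0)"
    unfolding coeff_avg_sum by (intro sum.cong refl coeff_avg_monomial) auto
  moreover have "\<dots> = ?c 1" by (subst sum.delta) auto
  ultimately show ?thesis by (simp add: mult_ac)
qed

definition coeff_avg_vec :: "nat \<Rightarrow> nat \<Rightarrow> (complex \<Rightarrow> 'h::complex_hilbert) \<Rightarrow> 'h" where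
  "coeff_avg_vec L n X = (1 / of_nat L) *\<^sub>C (\<Sum>r<L. unity_root L r ^ n *\<^sub>C X (unity_root L r))"

lemma cinner_avg_left: "cinner (coeff_avg_vec L n X) y = coeff_avg L n (\<lambda>\<mu>. cinner (X \<mu>) y)"
  by (simp add: coeff_avg_vec_def coeff_avg_def cinner_scaleC_left cinner_sum_left)

lemma cinner_avg_right: "cinner y (coeff_avg_vec L n X) = cnj (coeff_avg L n (\<lambda>\<mu>. cinner (X \<mu>) y))"
  by (metis cinner_avg_left cinner_commute)

lemma avg_in_subspace:
  assumes "complex_vector.subspace S" "\<And>\<mu>. cmod \<mu> = 1 \<Longrightarrow> X \<mu> \<in> S"
  shows "coeff_avg_vec L n X \<in> S"
  unfolding coeff_avg_vec_def
  by (intro complex_vector.subspace_scale[OF assms(1)] complex_vector.subspace_sum[OF assms(1)] assms(2))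
     simp

section \<open>Homogeneous functions in the reproducing kernel space\<close>

locale power_series_rkhs =
  fixes a :: "nat \<Rightarrow> real"
    and K :: "'e::complex_hilbert \<Rightarrow> 'e \<Rightarrow> complex"
    and ev :: "'h::complex_hilbert \<Rightarrow> 'e \<Rightarrow> complex"
  assumes a_pos: "a n > 0"
    and K_sums: "\<lbrakk>z \<in> ball 0 1; w \<in> ball 0 1\<rbrakk> \<Longrightarrow>
          (\<lambda>n. complex_of_real (a n) * cinner z w ^ n) sums K z w"
    and rkhs: "is_rkhs (ball 0 1) K ev"
begin

lemma ev_add: "z \<in> ball 0 1 \<Longrightarrow> ev (f + g) z = ev f z + ev g z"
  and ev_scaleC: "z \<in> ball 0 1 \<Longrightarrow> ev (c *\<^sub>C f) z = c * ev f z"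
  and ev_inject: "(\<And>z. z \<in> ball 0 1 \<Longrightarrow> ev f z = ev g z) \<Longrightarrow> f = g"
  using rkhs unfolding is_rkhs_def by blast+

definition kern :: "'e \<Rightarrow> 'h" where
  "kern w = (SOME k. (\<forall>z\<in>ball 0 1. ev k z = K z w) \<and> (\<forall>f. ev f w = cinner f k))"

lemma kern:
  assumes "w \<in> ball 0 1"
  shows "(\<forall>z\<in>ball 0 1. ev (kern w) z = K z w) \<and> (\<forall>f. ev f w = cinner f (kern w))"
  unfolding kern_def by (rule someI_ex) (use rkhs assms in \<open>auto simp: is_rkhs_def\<close>)

lemma ev_kern: "\<lbrakk>z \<in> ball 0 1; w \<in> ball 0 1\<rbrakk> \<Longrightarrow> ev (kern w) z = K z w"
  using kern by blast

lemma reproducing: "w \<in> ball 0 1 \<Longrightarrow> ev f w = cinner f (kern w)"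
  using kern by blast

lemma tendsto_ev: "\<lbrakk>(f \<longlongrightarrow> g) F; z \<in> ball 0 1\<rbrakk> \<Longrightarrow> ((\<lambda>x. ev (f x) z) \<longlongrightarrow> ev g z) F"
  by (simp add: reproducing tendsto_cinner_left)

lemma ev_avg: "z \<in> ball 0 1 \<Longrightarrow> ev (coeff_avg_vec L n X) z = coeff_avg L n (\<lambda>\<mu>. ev (X \<mu>) z)"
  by (simp add: reproducing cinner_avg_left)

lemma ev_sum: "z \<in> ball 0 1 \<Longrightarrow> ev (sum f Q) z = (\<Sum>q\<in>Q. ev (f q) z)"
  by (simp add: reproducing cinner_sum_left)

lemma a_nonzero [simp]: "a n \<noteq> 0"
  using a_pos[of n] by simp

text \<open>
  The terms are dominated by those of the kernel at \<open>(u, u)\<close>, where \<open>u\<close> is the longer one of the two points.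
\<close>

lemma summable_norm_kernel_terms:
  fixes z w :: 'e
  assumes "z \<in> ball 0 1" "w \<in> ball 0 1"
  shows "summable (\<lambda>n. cmod (complex_of_real (a n) * cinner z w ^ n))"
proof -
  define u where "u = (if norm z \<le> norm w then w else z)"
  have u: "u \<in> ball 0 1" using assms by (simp add: u_def)
  have "cmod (cinner z w) \<le> norm u * norm u"
    using norm_cinner_le[of z w] by (rule order_trans) (auto simp: u_def intro!: mult_mono)
  then have le: "cmod (cinner z w) \<le> (norm u)\<^sup>2" by (simp add: power2_eq_square)
  have "summable (\<lambda>n. complex_of_real (a n * ((norm u)\<^sup>2) ^ n))"
    using sums_summable[OF K_sums[OF u u]] by (simp add: cinner_self)
  then have "summable (\<lambda>n. a n * ((norm u)\<^sup>2) ^ n)"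
    by (simp only: summable_complex_of_real)
  then show ?thesis
    by (rule summable_comparison_test'[where N = 0])
       (simp add: norm_mult norm_power a_pos less_imp_le mult_left_mono power_mono le abs_of_pos)
qed

text \<open>
  The averages \<open>s\<^sub>L\<close> of the kernel functions at the points \<open>\<mu> w\<close> converge pointwise to the degree
  \<open>n\<close> part of the kernel.  They converge in norm: since \<open>\<langle>s\<^sub>k, s\<^sub>l\<rangle>\<close> is itself an average of values
  of \<open>s\<^sub>k\<close> at the points \<open>\<mu> w\<close>, it differs from \<open>a\<^sub>n \<parallel>w\<parallel>\<^sup>2\<^sup>n\<close> by at most the tail of the kernel
  series beyond \<open>k\<close>.
\<close>

lemma homogeneous_part_exists:
  assumes w: "w \<in> ball 0 1"
  shows "\<exists>x. (\<forall>z\<in>ball 0 1. ev x z = a n * cinner z w ^ n) \<and>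
             (\<lambda>L. coeff_avg_vec L n (\<lambda>\<mu>. kern (\<mu> *\<^sub>C w))) \<longlonglongrightarrow> x"
proof -
  define s where "s L = coeff_avg_vec L n (\<lambda>\<mu>. kern (\<mu> *\<^sub>C w))" for L
  \<comment> \<open>the tail of the kernel series bounds the error of the average with \<open>L\<close> roots of unity\<close>
  define t where "t z L = (\<Sum>m. cmod (a (m + L) * cinner z w ^ (m + L)))" for z L
  have rot: "\<mu> *\<^sub>C w \<in> ball 0 1" if "cmod \<mu> = 1" for \<mu>
    using w that by (simp add: norm_scaleC)
  have t0: "t z \<longlonglongrightarrow> 0" if "z \<in> ball 0 1" for z
    unfolding t_def by (rule suminf_exist_split2) (rule summable_norm_kernel_terms[OF that w])
  have ev_s: "cmod (ev (s L) z - a n * cinner z w ^ n) \<le> t z L" if "z \<in> ball 0 1" "n < L" for z L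
    unfolding s_def ev_avg[OF that(1)] t_def
  proof (rule coeff_avg_power_series[OF that(2)])
    show "summable (\<lambda>m. cmod (complex_of_real (a m) * cinner z w ^ m))"
      by (rule summable_norm_kernel_terms[OF that(1) w])
    fix \<mu> :: complex assume \<mu>: "cmod \<mu> = 1"
    show "(\<lambda>m. complex_of_real (a m) * cinner z w ^ m * cnj \<mu> ^ m) sums ev (kern (\<mu> *\<^sub>C w)) z"
      using K_sums[OF that(1) rot[OF \<mu>]]
      by (simp add: ev_kern[OF that(1) rot[OF \<mu>]] cinner_scaleC_right power_mult_distrib mult_ac)
  qed
  have "Cauchy s"
  proof (rule Cauchy_if_cinner_convergent)
    fix k l assume k: "Suc n \<le> k" and l: "Suc n \<le> l"
    \<comment> \<open>\<open>s k\<close> is nearly homogeneous of degree \<open>n\<close> on the circle of points \<open>\<mu> w\<close>, and \<open>s l\<close> averages over it\<close>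
    let ?A = "complex_of_real (a n) * cinner w w ^ n"
    have cnjA: "cnj ?A = ?A" using cinner_commute[of w w] by simp
    have "cmod (cnj (cinner (s k) (kern (\<mu> *\<^sub>C w)) ) - ?A * cnj \<mu> ^ n) \<le> t w k" if \<mu>: "cmod \<mu> = 1" for \<mu>
    proof -
      have "cmod (cnj (ev (s k) (\<mu> *\<^sub>C w) - a n * cinner (\<mu> *\<^sub>C w) w ^ n)) \<le> t (\<mu> *\<^sub>C w) k"
        unfolding complex_mod_cnj using k by (intro ev_s rot \<mu>) simp
      moreover have "t (\<mu> *\<^sub>C w) k = t w k"
        by (simp add: t_def cinner_scaleC_left norm_mult norm_power \<mu>)
      moreover have "cnj (ev (s k) (\<mu> *\<^sub>C w) - a n * cinner (\<mu> *\<^sub>C w) w ^ n)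
          = cnj (cinner (s k) (kern (\<mu> *\<^sub>C w))) - ?A * cnj \<mu> ^ n"
        using cinner_commute[of w w]
        by (simp add: reproducing[OF rot[OF \<mu>]] cinner_scaleC_left power_mult_distrib mult_ac)
      ultimately show ?thesis by simp
    qed
    then have "cmod (coeff_avg l n (\<lambda>\<mu>. cnj (cinner (s k) (kern (\<mu> *\<^sub>C w))) - ?A * cnj \<mu> ^ n)) \<le> t w k"
      using l by (intro coeff_avg_bound) auto
    then have "cmod (coeff_avg l n (\<lambda>\<mu>. cinner (kern (\<mu> *\<^sub>C w)) (s k)) - ?A) \<le> t w k"
      using l by (simp add: coeff_avg_diff coeff_avg_monomial cinner_commute[symmetric])
    then have "cmod (cnj (coeff_avg l n (\<lambda>\<mu>. cinner (kern (\<mu> *\<^sub>C w)) (s k)) - ?A)) \<le> t w k"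
      unfolding complex_mod_cnj .
    then show "cmod (cinner (s k) (s l) - ?A) \<le> t w k"
      unfolding complex_cnj_diff cnjA by (simp add: s_def[of l] cinner_avg_right)
  qed (rule t0[OF w])
  then obtain x where x: "s \<longlonglongrightarrow> x" using Cauchy_convergent_iff convergent_def by blast
  have "ev x z = a n * cinner z w ^ n" if z: "z \<in> ball 0 1" for z
  proof (rule LIMSEQ_unique[OF tendsto_ev[OF x z]])
    show "(\<lambda>L. ev (s L) z) \<longlonglongrightarrow> a n * cinner z w ^ n"
    proof (rule Lim_null[THEN iffD2], rule Lim_null_comparison[OF _ t0[OF z]])
      show "\<forall>\<^sub>F L in sequentially. norm (ev (s L) z - a n * cinner z w ^ n) \<le> t z L"
        using eventually_gt_at_top[of n] by eventually_elim (rule ev_s[OF z])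
    qed
  qed
  with x show ?thesis unfolding s_def by blast
qed

lemma in_ball_rescale:
  obtains r :: real where "r > 0" "complex_of_real r *\<^sub>C (w :: 'e) \<in> ball 0 1"
proof (rule that[of "1 / (norm w + 1)"])
  have pos: "norm w + 1 > 0" by (simp add: add_nonneg_pos)
  then show "1 / (norm w + 1) > 0" by simp
  show "complex_of_real (1 / (norm w + 1)) *\<^sub>C w \<in> ball 0 1"
    unfolding mem_ball_0 norm_scaleC norm_of_real using pos by (simp add: divide_less_eq)
qed

text \<open>
  The vector \<open>w\<close> may have any norm, although points of evaluation lie in the unit ball; this is what
  allows perturbing \<open>w\<close> by unimodular multiples of basis vectors below.
\<close>

definition hom_pow :: "nat \<Rightarrow> 'e \<Rightarrow> 'h" where
  "hom_pow n w = (SOME x. \<forall>z\<in>ball 0 1. ev x z = cinner z w ^ n)"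

lemma ev_hom:
  assumes "z \<in> ball 0 1"
  shows "ev (hom_pow n w) z = cinner z w ^ n"
proof -
  obtain r :: real where r: "r > 0" "complex_of_real r *\<^sub>C w \<in> ball 0 1" by (rule in_ball_rescale)
  obtain x where x: "\<forall>z\<in>ball 0 1. ev x z = a n * cinner z (complex_of_real r *\<^sub>C w) ^ n"
    using homogeneous_part_exists[OF r(2)] by blast
  have "\<forall>z\<in>ball 0 1. ev ((1 / complex_of_real (a n * r ^ n)) *\<^sub>C x) z = cinner z w ^ n"
    using r(1) a_pos[of n]
    by (auto simp: ev_scaleC x cinner_scaleC_right power_mult_distrib)
  then have "\<exists>x. \<forall>z\<in>ball 0 1. ev x z = cinner z w ^ n" by blast
  from someI_ex[OF this] show ?thesis using assms unfolding hom_pow_def by blast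
qed

lemma hom_scaleC: "hom_pow n (c *\<^sub>C w) = cnj c ^ n *\<^sub>C hom_pow n w"
  by (rule ev_inject) (simp add: ev_hom ev_scaleC cinner_scaleC_right power_mult_distrib)

lemma tendsto_hom:
  assumes "w \<in> ball 0 1"
  shows "(\<lambda>L. coeff_avg_vec L n (\<lambda>\<mu>. kern (\<mu> *\<^sub>C w))) \<longlonglongrightarrow> complex_of_real (a n) *\<^sub>C hom_pow n w"
proof -
  obtain x where x: "\<forall>z\<in>ball 0 1. ev x z = a n * cinner z w ^ n"
      "(\<lambda>L. coeff_avg_vec L n (\<lambda>\<mu>. kern (\<mu> *\<^sub>C w))) \<longlonglongrightarrow> x"
    using homogeneous_part_exists[OF assms] by blast
  have "x = complex_of_real (a n) *\<^sub>C hom_pow n w"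
    by (rule ev_inject) (simp add: x(1) ev_scaleC ev_hom)
  with x(2) show ?thesis by simp
qed

text \<open>
  The inner product with the averages that define \<open>hom_pow m v\<close> is an average of values of
  \<open>hom_pow n w\<close>, by the reproducing property.  The case of arbitrary \<open>v\<close> follows by scaling.
\<close>

lemma cinner_hom: "cinner (hom_pow n w) (hom_pow m v) = (if n = m then cinner v w ^ n / a n else 0)"
proof -
  have ball: "cinner (hom_pow n w) (hom_pow m v) = (if n = m then cinner v w ^ n / a n else 0)"
    if v: "v \<in> ball 0 1" for v
  proof -
    have rot: "\<mu> *\<^sub>C v \<in> ball 0 1" if "cmod \<mu> = 1" for \<mu>
      using v that by (simp add: norm_scaleC)
    let ?s = "\<lambda>L. coeff_avg_vec L m (\<lambda>\<mu>. kern (\<mu> *\<^sub>C v))"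
    have "cinner (?s L) (hom_pow n w) = (if n = m then cnj (cinner v w ^ n) else 0)" if "max n m < L" for L
    proof -
      have "cinner (?s L) (hom_pow n w) = coeff_avg L m (\<lambda>\<mu>. cnj (cinner v w ^ n) * cnj \<mu> ^ n)"
        unfolding cinner_avg_left
      proof (rule coeff_avg_cong)
        fix \<mu> :: complex assume "cmod \<mu> = 1"
        from rot[OF this] have "cinner (hom_pow n w) (kern (\<mu> *\<^sub>C v)) = (\<mu> * cinner v w) ^ n"
          by (simp add: reproducing[symmetric] ev_hom cinner_scaleC_left)
        then show "cinner (kern (\<mu> *\<^sub>C v)) (hom_pow n w) = cnj (cinner v w ^ n) * cnj \<mu> ^ n"
          by (subst cinner_commute) (simp add: power_mult_distrib)
      qed
      then show ?thesis using that by (simp add: coeff_avg_monomial)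
    qed
    then have "(\<lambda>L. cinner (?s L) (hom_pow n w)) \<longlonglongrightarrow> (if n = m then cnj (cinner v w ^ n) else 0)"
      by (intro tendsto_eventually) (use eventually_gt_at_top[of "max n m"] in eventually_elim, simp)
    moreover have "(\<lambda>L. cinner (?s L) (hom_pow n w)) \<longlonglongrightarrow> cinner (complex_of_real (a m) *\<^sub>C hom_pow m v) (hom_pow n w)"
      by (intro tendsto_cinner_left tendsto_hom v)
    ultimately have "a m * cinner (hom_pow m v) (hom_pow n w) = (if n = m then cnj (cinner v w ^ n) else 0)"
      using LIMSEQ_unique by (fastforce simp: cinner_scaleC_left)
    then have "cinner (hom_pow m v) (hom_pow n w) = (if n = m then cnj (cinner v w ^ n) / a n else 0)"
      using a_pos[of m] by (auto simp: field_simps)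
    then show ?thesis by (subst cinner_commute) simp
  qed
  obtain r :: real where r: "r > 0" "complex_of_real r *\<^sub>C v \<in> ball 0 1" by (rule in_ball_rescale)
  have "complex_of_real r ^ m * cinner (hom_pow n w) (hom_pow m v)
      = complex_of_real r ^ m * (if n = m then cinner v w ^ n / a n else 0)"
    using ball[OF r(2)]
    by (simp add: hom_scaleC cinner_scaleC_left cinner_scaleC_right power_mult_distrib split: if_splits)
  then show ?thesis using r(1) unfolding mult_left_cancel by simp
qed

end

section \<open>Functions of finitely many coordinates\<close>

lemma cinner_lincomb:
  fixes x y :: "'q \<Rightarrow> 'a::complex_hilbert"
  shows "cinner (\<Sum>q\<in>Q. c q *\<^sub>C x q) (\<Sum>q\<in>Q. d q *\<^sub>C y q)
    = (\<Sum>q\<in>Q. \<Sum>p\<in>Q. c q * cnj (d p) * cinner (x q) (y p))"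
  by (subst cinner_sum_left)
    (simp add: cinner_sum_right cinner_scaleC_left cinner_scaleC_right sum_distrib_left mult_ac)

lemma sum_swap_innermost: "(\<Sum>k\<in>A. \<Sum>q\<in>Q. \<Sum>p\<in>P. f k q p) = (\<Sum>q\<in>Q. \<Sum>p\<in>P. \<Sum>k\<in>A. f k q p)"
proof -
  have "(\<Sum>k\<in>A. \<Sum>q\<in>Q. \<Sum>p\<in>P. f k q p) = (\<Sum>q\<in>Q. \<Sum>k\<in>A. \<Sum>p\<in>P. f k q p)"
    by (rule sum.swap)
  also have "\<dots> = (\<Sum>q\<in>Q. \<Sum>p\<in>P. \<Sum>k\<in>A. f k q p)"
    by (rule sum.cong[OF refl], rule sum.swap)
  finally show ?thesis .
qed

text \<open>
  The bound \<open>C\<close> for the ratios \<open>a\<^sub>n / a\<^sub>n\<^sub>+\<^sub>1\<close> makes every coordinate a multiplier of norm at most \<open>\<surd>C\<close>.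
\<close>

locale coordinate_rkhs = power_series_rkhs a K ev
  for a :: "nat \<Rightarrow> real"
    and K :: "'e::complex_hilbert \<Rightarrow> 'e \<Rightarrow> complex"
    and ev :: "'h::complex_hilbert \<Rightarrow> 'e \<Rightarrow> complex" +
  fixes e :: "nat \<Rightarrow> 'e" and C :: real
  assumes onb: "orthonormal_basis e"
    and ratio: "a n \<le> C * a (Suc n)"
begin

lemma cinner_e: "cinner (e i) (e j) = (if i = j then 1 else 0)"
  using onb by (simp add: orthonormal_basis_def)

abbreviation V :: "'e set" where "V \<equiv> complex_vector.span (range e)"

text \<open>
  A finite combination of basis vectors is orthogonal to almost all of them, and Parseval's
  identity for it is a finite sum.
\<close>

lemma finite_support:
  assumes "w \<in> V"
  shows "\<exists>m. \<forall>m'\<ge>m. cinner w (e m') = 0 \<and>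
     (\<forall>v. cinner v w = (\<Sum>k<m'. cinner v (e k) * cnj (cinner w (e k))))"
  using assms
proof (induction rule: complex_vector.span_induct_alt)
  case base
  show ?case by simp
next
  case (step c x y)
  then obtain i m where x: "x = e i"
    and m: "\<And>m'. m' \<ge> m \<Longrightarrow> cinner y (e m') = 0"
      "\<And>m' v. m' \<ge> m \<Longrightarrow> cinner v y = (\<Sum>k<m'. cinner v (e k) * cnj (cinner y (e k)))"
    by blast
  have "cinner (c *\<^sub>C x + y) (e m') = 0 \<and> (\<forall>v. cinner v (c *\<^sub>C x + y)
      = (\<Sum>k<m'. cinner v (e k) * cnj (cinner (c *\<^sub>C x + y) (e k))))" if "m' \<ge> max m (Suc i)" for m'
  proof -
    have delta: "(\<Sum>k<m'. cinner v (e k) * cnj (if i = k then 1 else 0)) = cinner v (e i)" for v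
    proof -
      have "(\<Sum>k<m'. cinner v (e k) * cnj (if i = k then 1 else 0)) = (\<Sum>k<m'. if k = i then cinner v (e k) else 0)"
        by (intro sum.cong) auto
      then show ?thesis using that by simp
    qed
    have "cinner v (c *\<^sub>C x) = (\<Sum>k<m'. cinner v (e k) * cnj (c * (if i = k then 1 else 0)))" for v
      unfolding x cinner_scaleC_right delta[symmetric] sum_distrib_left by (intro sum.cong) auto
    then show ?thesis
      using that m
      by (auto simp: x cinner_add_left cinner_add_right cinner_scaleC_left cinner_e sum.distrib distrib_left)
  qed
  then show ?case by blast
qed

definition poly_span :: "'h set" where
  "poly_span = complex_vector.span {hom_pow n w |n w. w \<in> V}"

lemma subspace_poly_span: "complex_vector.subspace poly_span"
  unfolding poly_span_def by (rule complex_vector.subspace_span)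

lemma hom_pow_in_poly_span: "w \<in> V \<Longrightarrow> hom_pow n w \<in> poly_span"
  unfolding poly_span_def by (rule complex_vector.span_base) blast

text \<open>
  The function \<open>z \<mapsto> z\<^sub>i \<langle>z, w\<rangle>\<^sup>n\<close>, written as \<open>1 / (n + 1)\<close> times the coefficient of \<open>cnj \<mu>\<close> in
  \<open>\<langle>z, w + \<mu> e\<^sub>i\<rangle>\<^sup>n\<^sup>+\<^sup>1\<close>.
\<close>

definition coord_hom :: "nat \<Rightarrow> nat \<Rightarrow> 'e \<Rightarrow> 'h" where
  "coord_hom i n w =
     (1 / of_nat (Suc n)) *\<^sub>C coeff_avg_vec (Suc (Suc n)) 1 (\<lambda>\<mu>. hom_pow (Suc n) (w + \<mu> *\<^sub>C e i))"

lemma ev_coord_hom: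
  assumes z: "z \<in> ball 0 1"
  shows "ev (coord_hom i n w) z = cinner z (e i) * cinner z w ^ n"
proof -
  have "(\<lambda>\<mu>. cinner z (w + \<mu> *\<^sub>C e i) ^ Suc n) = (\<lambda>\<mu>. (cinner z w + cnj \<mu> * cinner z (e i)) ^ Suc n)"
    by (simp only: cinner_add_right cinner_scaleC_right)
  then show ?thesis
    unfolding coord_hom_def ev_scaleC[OF z] ev_avg[OF z] ev_hom[OF z]
    by (simp only: coeff_avg_affine_power) (simp del: of_nat_Suc)
qed

lemma cinner_coord_hom:
  "cinner (coord_hom i n w) (hom_pow m v) = (if m = Suc n then cinner v (e i) * cinner v w ^ n / a m else 0)"
proof (cases "m = Suc n")
  case True
  have "cinner (coord_hom i n w) (hom_pow m v) =
      coeff_avg (Suc (Suc n)) 1 (\<lambda>\<mu>. (cinner v w + cnj \<mu> * cinner v (e i)) ^ Suc n * (1 / a m)) / of_nat (Suc n)"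
    by (simp add: coord_hom_def cinner_scaleC_left cinner_avg_left cinner_hom True cinner_add_right
        cinner_scaleC_right del: power_Suc of_nat_Suc)
  then show ?thesis
    using True unfolding coeff_avg_mult_right coeff_avg_affine_power by (simp del: of_nat_Suc)
next
  case False
  then show ?thesis
    by (simp add: coord_hom_def cinner_scaleC_left cinner_avg_left cinner_hom coeff_avg_def del: of_nat_Suc)
qed

lemma coord_hom_in_poly_span:
  assumes "w \<in> V"
  shows "coord_hom i n w \<in> poly_span"
proof -
  have "w + \<mu> *\<^sub>C e i \<in> V" for \<mu>
    by (intro complex_vector.span_add[OF assms] complex_vector.span_scale complex_vector.span_base) auto
  then show ?thesis
    unfolding coord_hom_def
    by (intro complex_vector.subspace_scale[OF subspace_poly_span] avg_in_subspace[OF subspace_poly_span] hom_pow_in_poly_span)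
qed

lemma tendsto_hom_arg:
  assumes "w \<longlonglongrightarrow> v"
  shows "(\<lambda>l. hom_pow n (w l)) \<longlonglongrightarrow> hom_pow n v"
proof -
  have eq: "complex_of_real ((norm (hom_pow n (w l) - hom_pow n v))\<^sup>2)
    = (complex_of_real ((norm (w l))\<^sup>2) ^ n - cinner v (w l) ^ n - cinner (w l) v ^ n
        + complex_of_real ((norm v)\<^sup>2) ^ n) / a n" for l
    unfolding cinner_self[symmetric]
    by (simp add: cinner_diff_left cinner_diff_right cinner_hom diff_divide_distrib add_divide_distrib)
  have "(\<lambda>l. complex_of_real ((norm (hom_pow n (w l) - hom_pow n v))\<^sup>2)) \<longlonglongrightarrow>
     (complex_of_real ((norm v)\<^sup>2) ^ n - cinner v v ^ n - cinner v v ^ n + complex_of_real ((norm v)\<^sup>2) ^ n) / a n"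
    unfolding eq using a_pos[of n]
    by (intro tendsto_intros tendsto_cinner_left tendsto_cinner_right assms) simp
  then have "(\<lambda>l. complex_of_real ((norm (hom_pow n (w l) - hom_pow n v))\<^sup>2)) \<longlonglongrightarrow> complex_of_real 0"
    by (simp add: cinner_self)
  then have "(\<lambda>l. (norm (hom_pow n (w l) - hom_pow n v))\<^sup>2) \<longlonglongrightarrow> 0"
    unfolding tendsto_of_real_iff .
  then have "(\<lambda>l. sqrt ((norm (hom_pow n (w l) - hom_pow n v))\<^sup>2)) \<longlonglongrightarrow> sqrt 0"
    by (rule tendsto_real_sqrt)
  then show ?thesis by (simp add: tendsto_norm_zero_iff Lim_null[symmetric])
qed

text \<open>
  Both the partial sums \<open>p\<^sub>l\<close> and their inner products with \<open>kern w\<close> give the partial sums of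
  \<open>K w w\<close>, so that \<open>\<parallel>kern w - p\<^sub>l\<parallel>\<^sup>2\<close> is a remainder of that series.
\<close>

lemma kern_sums:
  assumes w: "w \<in> ball 0 1"
  shows "(\<lambda>n. complex_of_real (a n) *\<^sub>C hom_pow n w) sums kern w"
proof -
  define p where "p l = (\<Sum>n<l. complex_of_real (a n) *\<^sub>C hom_pow n w)" for l
  let ?s = "\<lambda>l. \<Sum>n<l. complex_of_real (a n) * cinner w w ^ n"
  have pk: "cinner (p l) (kern w) = ?s l" for l
    by (simp add: p_def cinner_sum_left cinner_scaleC_left reproducing[OF w, symmetric] ev_sum[OF w] ev_scaleC[OF w] ev_hom[OF w])
  have pp: "cinner (p l) (p l) = ?s l" for l
  proof -
    have "cinner (p l) (p l) = (\<Sum>n<l. \<Sum>m<l. if n = m then complex_of_real (a n) * cinner w w ^ n else 0)"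
      unfolding p_def cinner_lincomb
      by (intro sum.cong refl) (auto simp: cinner_hom)
    then show ?thesis by simp
  qed
  have kp: "cinner (kern w) (p l) = ?s l" for l
    using cinner_commute[of "kern w" "p l"] pp[of l] pk[of l] cinner_commute[of "p l" "p l"] by simp
  have kk: "cinner (kern w) (kern w) = K w w"
    by (simp add: reproducing[OF w, symmetric] ev_kern[OF w w])
  have eq: "complex_of_real ((norm (kern w - p l))\<^sup>2) = K w w - ?s l" for l
    unfolding cinner_self[symmetric]
    by (simp add: cinner_diff_left cinner_diff_right pk pp kp kk)
  have "(\<lambda>l. complex_of_real ((norm (kern w - p l))\<^sup>2)) \<longlonglongrightarrow> K w w - K w w"
    unfolding eq using K_sums[OF w w] unfolding sums_def by (intro tendsto_diff tendsto_const)
  then have "(\<lambda>l. complex_of_real ((norm (kern w - p l))\<^sup>2)) \<longlonglongrightarrow> complex_of_real 0" by simp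
  then have "(\<lambda>l. (norm (kern w - p l))\<^sup>2) \<longlonglongrightarrow> 0"
    unfolding tendsto_of_real_iff .
  then have "(\<lambda>l. sqrt ((norm (kern w - p l))\<^sup>2)) \<longlonglongrightarrow> sqrt 0"
    by (rule tendsto_real_sqrt)
  then have "(\<lambda>l. p l - kern w) \<longlonglongrightarrow> 0"
    by (simp add: norm_minus_commute[of "kern w"] tendsto_norm_zero_iff)
  then show ?thesis
    unfolding sums_def p_def[symmetric] by (simp only: Lim_null[symmetric])
qed

text \<open>
  A function orthogonal to \<open>poly_span\<close> is orthogonal to \<open>hom_pow n w\<close> for every \<open>w\<close>, by density of the
  finite combinations of basis vectors and continuity in \<open>w\<close>.  Hence it is orthogonal to all kernel
  functions, that is, it vanishes on the ball.
\<close>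

lemma closure_poly_span: "closure poly_span = UNIV"
proof (rule dense_if_orthogonal_trivial[OF subspace_poly_span])
  fix f assume f: "\<And>x. x \<in> poly_span \<Longrightarrow> cinner x f = 0"
  have hom0: "cinner (hom_pow n w) f = 0" for n w
  proof -
    have "w \<in> closure V" using onb by (simp add: orthonormal_basis_def)
    then obtain v where v: "\<And>l. v l \<in> V" "v \<longlonglongrightarrow> w" unfolding closure_sequential by blast
    have "(\<lambda>l. cinner (hom_pow n (v l)) f) \<longlonglongrightarrow> cinner (hom_pow n w) f"
      by (intro tendsto_cinner_left tendsto_hom_arg v(2))
    moreover have "cinner (hom_pow n (v l)) f = 0" for l by (intro f hom_pow_in_poly_span v(1))
    ultimately show ?thesis using LIMSEQ_unique[OF _ tendsto_const] by fastforce
  qed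
  show "f = 0"
  proof (rule ev_inject)
    fix z :: 'e assume z: "z \<in> ball 0 1"
    have "(\<lambda>l. cinner (\<Sum>n<l. complex_of_real (a n) *\<^sub>C hom_pow n z) f) \<longlonglongrightarrow> cinner (kern z) f"
      using kern_sums[OF z] unfolding sums_def by (rule tendsto_cinner_left)
    then have "cinner (kern z) f = 0"
      by (simp add: cinner_sum_left cinner_scaleC_left hom0 LIMSEQ_const_iff)
    then show "ev f z = ev 0 z"
      using cinner_commute[of f "kern z"] by (simp add: reproducing[OF z])
  qed
qed

text \<open>
  The value at \<open>0\<close> reflects that the adjoint of a coordinate multiplication kills constants.
\<close>

definition weight_ratio :: "nat \<Rightarrow> real" where
  "weight_ratio n = (if n = 0 then 0 else a (n - 1) / a n)"

lemma C_pos: "0 < C"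
proof -
  have "0 < C * a (Suc 0)" using ratio[of 0] a_pos[of 0] by linarith
  then show ?thesis using a_pos by (rule zero_less_mult_pos2)
qed

lemma weight_ratio_le: "weight_ratio n \<le> C"
  using C_pos ratio[of "n - 1"] a_pos[of n] by (auto simp: weight_ratio_def divide_le_eq)

text \<open>
  The sum on the left is \<open>T\<^sub>i\<^sup>* x\<close> for the \<open>x\<close> on the right, as
  \<open>T\<^sub>i\<^sup>* h\<^sub>n\<^sub>,\<^sub>w = cnj w\<^sub>i (a\<^sub>n\<^sub>-\<^sub>1 / a\<^sub>n) h\<^sub>n\<^sub>-\<^sub>1\<^sub>,\<^sub>w\<close>.  The point is that all coordinates together form a bounded
  column.  With \<open>y\<close> arising from \<open>x\<close> by multiplying its degree \<open>n\<close> part by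
  \<open>\<surd>(C - a\<^sub>n\<^sub>-\<^sub>1 / a\<^sub>n)\<close>, comparing Gram matrices gives \<open>\<Sum>\<^sub>k \<parallel>T\<^sub>k\<^sup>* x\<parallel>\<^sup>2 + \<parallel>y\<parallel>\<^sup>2 = C \<parallel>x\<parallel>\<^sup>2\<close>.
\<close>

lemma formal_adjoint_bound:
  fixes c :: "nat \<times> 'e \<Rightarrow> complex"
  assumes Q: "finite Q" "Q \<subseteq> UNIV \<times> V"
  shows "norm (\<Sum>q\<in>Q. (c q * cnj (cinner (snd q) (e i)) * weight_ratio (fst q)) *\<^sub>C hom_pow (fst q - 1) (snd q))
    \<le> sqrt C * norm (\<Sum>q\<in>Q. c q *\<^sub>C hom_pow (fst q) (snd q))"
proof -
  define S where "S k = (\<Sum>q\<in>Q. (c q * cnj (cinner (snd q) (e k)) * weight_ratio (fst q)) *\<^sub>C hom_pow (fst q - 1) (snd q))" for k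
  define x where "x = (\<Sum>q\<in>Q. c q *\<^sub>C hom_pow (fst q) (snd q))"
  define y where "y = (\<Sum>q\<in>Q. (c q * complex_of_real (sqrt (C - weight_ratio (fst q)))) *\<^sub>C hom_pow (fst q) (snd q))"
  have "\<forall>q\<in>Q. \<exists>m. \<forall>m'\<ge>m. \<forall>v. cinner v (snd q) = (\<Sum>k<m'. cinner v (e k) * cnj (cinner (snd q) (e k)))"
    using Q(2) finite_support by fastforce
  then obtain m where m: "\<And>q m' v. q \<in> Q \<Longrightarrow> m' \<ge> m q \<Longrightarrow>
      cinner v (snd q) = (\<Sum>k<m'. cinner v (e k) * cnj (cinner (snd q) (e k)))" by metis
  \<comment> \<open>large enough to exceed \<open>i\<close> and to cover the supports of all vectors in \<open>Q\<close>\<close>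
  define d where "d = Suc (i + (\<Sum>q\<in>Q. m q))"
  have parseval: "cinner v (snd q) = (\<Sum>k<d. cinner v (e k) * cnj (cinner (snd q) (e k)))" if "q \<in> Q" for q v
    using that member_le_sum[of q Q m] Q(1) by (intro m) (auto simp: d_def)
  define A where "A q p = (\<Sum>k<d. (c q * cnj (cinner (snd q) (e k)) * weight_ratio (fst q)) *
      cnj (c p * cnj (cinner (snd p) (e k)) * weight_ratio (fst p)) *
      cinner (hom_pow (fst q - 1) (snd q)) (hom_pow (fst p - 1) (snd p)))" for q p
  define B where "B q p = (c q * complex_of_real (sqrt (C - weight_ratio (fst q)))) *
      cnj (c p * complex_of_real (sqrt (C - weight_ratio (fst p)))) *
      cinner (hom_pow (fst q) (snd q)) (hom_pow (fst p) (snd p))" for q p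
  define X where "X q p = c q * cnj (c p) * cinner (hom_pow (fst q) (snd q)) (hom_pow (fst p) (snd p))" for q p
  have summand: "A q p + B q p = complex_of_real C * X q p" if q: "q \<in> Q" for q p
  proof -
    define h where "h = cinner (hom_pow (fst q - 1) (snd q)) (hom_pow (fst p - 1) (snd p))"
    define g where "g = cinner (hom_pow (fst q) (snd q)) (hom_pow (fst p) (snd p))"
    have X: "X q p = c q * cnj (c p) * g" by (simp add: X_def g_def)
    have A: "A q p = c q * cnj (c p) * (complex_of_real (weight_ratio (fst q)) * weight_ratio (fst p) * h * cinner (snd p) (snd q))"
      unfolding A_def parseval[OF q] h_def[symmetric] sum_distrib_left
      by (intro sum.cong refl) (simp add: mult_ac)
    have B: "B q p = c q * cnj (c p) * g * complex_of_real (sqrt (C - weight_ratio (fst q)) * sqrt (C - weight_ratio (fst p)))"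
      by (simp add: B_def g_def mult_ac)
    show ?thesis
    proof (cases "fst q = fst p")
      case False
      then have "g = 0" by (simp add: g_def cinner_hom)
      moreover have "complex_of_real (weight_ratio (fst q)) * weight_ratio (fst p) * h = 0"
        using False by (cases "fst q"; cases "fst p") (auto simp: h_def cinner_hom weight_ratio_def)
      ultimately show ?thesis unfolding A B X by simp
    next
      case True
      have "complex_of_real (weight_ratio (fst q)) * h * cinner (snd p) (snd q) = g \<or> fst q = 0"
      proof (cases "fst q")
        case (Suc n)
        with True have "fst p = Suc n" by simp
        with Suc show ?thesis by (simp add: h_def g_def cinner_hom weight_ratio_def)
      qed simp
      then have "complex_of_real (weight_ratio (fst q)) * weight_ratio (fst q) * h * cinner (snd p) (snd q) = weight_ratio (fst q) * g"
        by (auto simp: weight_ratio_def)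
      then have A': "A q p = c q * cnj (c p) * (complex_of_real (weight_ratio (fst q)) * g)"
        unfolding A True[symmetric] by (simp only:)
      have "sqrt (C - weight_ratio (fst q)) * sqrt (C - weight_ratio (fst q)) = C - weight_ratio (fst q)"
        using weight_ratio_le[of "fst q"] by simp
      then have B': "B q p = c q * cnj (c p) * g * (complex_of_real C - complex_of_real (weight_ratio (fst q)))"
        unfolding B True[symmetric] by (simp only: of_real_diff)
      have "u * (r * g) + u * g * (t - r) = t * (u * g)" for u r t :: complex
        by (simp add: algebra_simps)
      then show ?thesis unfolding A' B' X .
    qed
  qed
  have "complex_of_real ((\<Sum>k<d. (norm (S k))\<^sup>2) + (norm y)\<^sup>2) = (\<Sum>k<d. cinner (S k) (S k)) + cinner y y"
    by (simp only: cinner_self of_real_add of_real_sum)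
  also have "(\<Sum>k<d. cinner (S k) (S k)) = (\<Sum>q\<in>Q. \<Sum>p\<in>Q. A q p)"
    unfolding S_def cinner_lincomb A_def by (rule sum_swap_innermost)
  also have "cinner y y = (\<Sum>q\<in>Q. \<Sum>p\<in>Q. B q p)"
    unfolding y_def cinner_lincomb B_def by (rule refl)
  also have "(\<Sum>q\<in>Q. \<Sum>p\<in>Q. A q p) + (\<Sum>q\<in>Q. \<Sum>p\<in>Q. B q p) = (\<Sum>q\<in>Q. \<Sum>p\<in>Q. A q p + B q p)"
    by (simp only: sum.distrib)
  also have "\<dots> = (\<Sum>q\<in>Q. \<Sum>p\<in>Q. complex_of_real C * X q p)"
    by (rule sum.cong[OF refl], rule sum.cong[OF refl], rule summand)
  also have "\<dots> = complex_of_real C * cinner x x"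
    unfolding x_def cinner_lincomb X_def sum_distrib_left by (rule refl)
  also have "\<dots> = complex_of_real (C * (norm x)\<^sup>2)"
    by (simp only: cinner_self of_real_mult)
  finally have eq: "(\<Sum>k<d. (norm (S k))\<^sup>2) + (norm y)\<^sup>2 = C * (norm x)\<^sup>2"
    unfolding of_real_eq_iff .
  have "(norm (S i))\<^sup>2 \<le> (\<Sum>k<d. (norm (S k))\<^sup>2)"
    by (rule member_le_sum) (auto simp: d_def)
  then have "(norm (S i))\<^sup>2 \<le> C * (norm x)\<^sup>2"
    using eq zero_le_power2[of "norm y"] by linarith
  then have "(norm (S i))\<^sup>2 \<le> (sqrt C * norm x)\<^sup>2"
    using C_pos by (simp add: power_mult_distrib)
  then have "norm (S i) \<le> sqrt C * norm x"
    by (rule power2_le_imp_le) (use C_pos in simp)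
  then show ?thesis unfolding S_def x_def .
qed

lemma poly_span_explicit:
  assumes "p \<in> poly_span"
  obtains Q c where "finite Q" "Q \<subseteq> UNIV \<times> V" "p = (\<Sum>q\<in>Q. c q *\<^sub>C hom_pow (fst q) (snd q))"
proof -
  let ?h = "\<lambda>q. hom_pow (fst q) (snd q)"
  have "{hom_pow n w |n w. w \<in> V} = ?h ` (UNIV \<times> V)" by force
  with assms obtain t r where t: "finite t" "t \<subseteq> ?h ` (UNIV \<times> V)" and p: "p = (\<Sum>x\<in>t. r x *\<^sub>C x)"
    unfolding poly_span_def complex_vector.span_explicit by auto
  from t(2) obtain Q where Q: "Q \<subseteq> UNIV \<times> V" "inj_on ?h Q" "t = ?h ` Q"
    unfolding subset_image_inj by blast
  have "p = (\<Sum>q\<in>Q. r (?h q) *\<^sub>C ?h q)"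
    unfolding p Q(3) by (subst sum.reindex[OF Q(2)]) simp
  moreover have "finite Q" using t(1) unfolding Q(3) finite_image_iff[OF Q(2)] .
  ultimately show thesis using Q(1) by (intro that)
qed

text \<open>
  The bound for the formal adjoint transfers to the product \<open>g\<close>: as \<open>g\<close> lies in \<open>poly_span\<close> itself, it can be
  tested against \<open>g\<close>, which gives \<open>\<parallel>g\<parallel>\<^sup>2 = \<langle>p, T\<^sub>i\<^sup>* g\<rangle> \<le> \<parallel>p\<parallel> \<surd>C \<parallel>g\<parallel>\<close>.
\<close>

lemma coord_product_poly_span:
  assumes "p \<in> poly_span"
  shows "\<exists>g. (\<forall>z\<in>ball 0 1. ev g z = cinner z (e i) * ev p z) \<and> norm g \<le> sqrt C * norm p"
proof -
  have adjoint: "\<exists>y. norm y \<le> sqrt C * norm x \<and>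
      (\<forall>n w. cinner (coord_hom i n w) x = cinner (hom_pow n w) y)" if x: "x \<in> poly_span" for x
  proof -
    obtain Q c where Q: "finite Q" "Q \<subseteq> UNIV \<times> V" and x: "x = (\<Sum>q\<in>Q. c q *\<^sub>C hom_pow (fst q) (snd q))"
      by (rule poly_span_explicit[OF x])
    let ?y = "\<Sum>q\<in>Q. (c q * cnj (cinner (snd q) (e i)) * weight_ratio (fst q)) *\<^sub>C hom_pow (fst q - 1) (snd q)"
    have "cinner (coord_hom i n w) (hom_pow m v)
        = cinner v (e i) * weight_ratio m * cinner (hom_pow n w) (hom_pow (m - 1) v)" for n w m v
      by (cases m) (auto simp: cinner_coord_hom cinner_hom weight_ratio_def)
    then have "cinner (coord_hom i n w) x = cinner (hom_pow n w) ?y" for n w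
      by (simp add: x cinner_sum_right cinner_scaleC_right mult_ac)
    moreover have "norm ?y \<le> sqrt C * norm x"
      unfolding x by (rule formal_adjoint_bound[OF Q])
    ultimately show ?thesis by (intro exI[of _ ?y]) simp
  qed
  obtain Q c where Q: "finite Q" "Q \<subseteq> UNIV \<times> V" and p: "p = (\<Sum>q\<in>Q. c q *\<^sub>C hom_pow (fst q) (snd q))"
    by (rule poly_span_explicit[OF assms])
  define g where "g = (\<Sum>q\<in>Q. c q *\<^sub>C coord_hom i (fst q) (snd q))"
  have "g \<in> poly_span"
    unfolding g_def using Q(2)
    by (intro complex_vector.subspace_sum[OF subspace_poly_span] complex_vector.subspace_scale[OF subspace_poly_span]
          coord_hom_in_poly_span) auto
  then obtain y where y: "norm y \<le> sqrt C * norm g" "\<And>n w. cinner (coord_hom i n w) g = cinner (hom_pow n w) y"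
    using adjoint by blast
  have "cinner g g = cinner p y"
    by (subst (1) g_def) (simp add: p cinner_sum_left cinner_scaleC_left y(2))
  then have "(norm g)\<^sup>2 \<le> norm p * norm y"
    using norm_cinner_le[of p y] norm_of_real[of "(norm g)\<^sup>2", where ?'a = complex]
    unfolding cinner_self by simp
  also have "\<dots> \<le> norm p * (sqrt C * norm g)" by (intro mult_left_mono y(1)) simp
  finally have "norm g \<le> sqrt C * norm p"
    by (cases "norm g = 0") (use C_pos in \<open>auto simp: power2_eq_square mult_ac\<close>)
  moreover have "ev g z = cinner z (e i) * ev p z" if "z \<in> ball 0 1" for z
    unfolding g_def p
    by (simp add: ev_sum[OF that] ev_scaleC[OF that] ev_coord_hom[OF that] ev_hom[OF that]
        sum_distrib_left mult_ac)
  ultimately show ?thesis by blast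
qed

section \<open>Multiplication by coordinates\<close>

text \<open>
  Extension from the dense subspace \<open>poly_span\<close> by continuity; the limit is the product because
  evaluation is continuous.
\<close>

lemma coord_product:
  "\<exists>g. (\<forall>z\<in>ball 0 1. ev g z = cinner z (e i) * ev f z) \<and> norm g \<le> sqrt C * norm f"
proof -
  have "f \<in> closure poly_span" by (simp add: closure_poly_span)
  then obtain p where p: "\<And>l. p l \<in> poly_span" "p \<longlonglongrightarrow> f" unfolding closure_sequential by blast
  obtain g where g: "\<And>l z. z \<in> ball 0 1 \<Longrightarrow> ev (g l) z = cinner z (e i) * ev (p l) z"
      "\<And>l. norm (g l) \<le> sqrt C * norm (p l)"
    using coord_product_poly_span[OF p(1)] by metis
  have lip: "norm (g k - g l) \<le> sqrt C * norm (p k - p l)" for k l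
  proof -
    have "p k - p l \<in> poly_span" by (intro complex_vector.subspace_diff[OF subspace_poly_span] p(1))
    then obtain h where h: "\<And>z. z \<in> ball 0 1 \<Longrightarrow> ev h z = cinner z (e i) * ev (p k - p l) z"
        "norm h \<le> sqrt C * norm (p k - p l)"
      using coord_product_poly_span by blast
    have "g k - g l = h"
    proof (rule ev_inject)
      fix z :: 'e assume z: "z \<in> ball 0 1"
      show "ev (g k - g l) z = ev h z"
        using g(1)[OF z, of k] g(1)[OF z, of l] h(1)[OF z]
        by (simp add: reproducing[OF z] cinner_diff_left right_diff_distrib)
    qed
    with h(2) show ?thesis by simp
  qed
  have "Cauchy g"
  proof (rule metric_CauchyI)
    fix \<epsilon> :: real assume "\<epsilon> > 0"
    then have "\<epsilon> / sqrt C > 0" using C_pos by simp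
    moreover have "Cauchy p" using p(2) by (rule LIMSEQ_imp_Cauchy)
    ultimately obtain N where N: "\<forall>k\<ge>N. \<forall>l\<ge>N. dist (p k) (p l) < \<epsilon> / sqrt C"
      using metric_CauchyD by blast
    have "dist (g k) (g l) < \<epsilon>" if "k \<ge> N" "l \<ge> N" for k l
    proof -
      have "norm (p k - p l) < \<epsilon> / sqrt C" using N that by (simp add: dist_norm)
      then have "sqrt C * norm (p k - p l) < \<epsilon>"
        using C_pos by (simp add: pos_less_divide_eq mult.commute)
      then show ?thesis using lip[of k l] by (simp add: dist_norm)
    qed
    then show "\<exists>N. \<forall>k\<ge>N. \<forall>l\<ge>N. dist (g k) (g l) < \<epsilon>" by blast
  qed
  then obtain h where h: "g \<longlonglongrightarrow> h" using Cauchy_convergent_iff convergent_def by blast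
  have "ev h z = cinner z (e i) * ev f z" if z: "z \<in> ball 0 1" for z
  proof (rule LIMSEQ_unique[OF tendsto_ev[OF h z]])
    show "(\<lambda>l. ev (g l) z) \<longlonglongrightarrow> cinner z (e i) * ev f z"
      unfolding g(1)[OF z] by (intro tendsto_mult tendsto_const tendsto_ev[OF p(2) z])
  qed
  moreover have "norm h \<le> sqrt C * norm f"
    by (rule LIMSEQ_le[OF tendsto_norm[OF h] tendsto_mult[OF tendsto_const tendsto_norm[OF p(2)]]])
       (use g(2) in blast)
  ultimately show ?thesis by blast
qed

abbreviation T :: "nat \<Rightarrow> 'h \<Rightarrow> 'h" where
  "T i \<equiv> mult_op (ball 0 1) ev (coord e i)"

text \<open>
  This shows that the definite description in \<open>mult_op\<close> denotes the product.
\<close>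

lemma mult_coord:
  "(\<forall>z\<in>ball 0 1. ev (T i f) z = cinner z (e i) * ev f z) \<and> norm (T i f) \<le> sqrt C * norm f"
proof -
  obtain g where g: "\<forall>z\<in>ball 0 1. ev g z = cinner z (e i) * ev f z" "norm g \<le> sqrt C * norm f"
    using coord_product by blast
  have "T i f = g"
    unfolding mult_op_def coord_def by (rule the_equality) (use g(1) in \<open>auto intro: ev_inject\<close>)
  with g show ?thesis by simp
qed

lemma ev_T: "z \<in> ball 0 1 \<Longrightarrow> ev (T i f) z = cinner z (e i) * ev f z"
  using mult_coord by blast

lemma norm_T_le: "norm (T i f) \<le> sqrt C * norm f"
  using mult_coord by blast

lemma T_add: "T i (f + g) = T i f + T i g"
  by (rule ev_inject) (simp only: ev_T ev_add distrib_left)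

lemma T_scaleC: "T i (c *\<^sub>C f) = c *\<^sub>C T i f"
  by (rule ev_inject) (simp only: ev_T ev_scaleC mult.left_commute)

lemma bounded_linear_T: "bounded_linear (T i)"
proof (rule bounded_linear_intro[of _ "sqrt C"])
  show "norm (T i f) \<le> norm f * sqrt C" for f
    using norm_T_le[of i f] by (simp only: mult.commute)
qed (simp_all only: T_add T_scaleC scaleR_conv_scaleC)

lemma T_hom: "T i (hom_pow n w) = coord_hom i n w"
  by (rule ev_inject) (simp only: ev_T ev_hom ev_coord_hom)

lemma T_sum: "T i (sum f Q) = (\<Sum>q\<in>Q. T i (f q))"
  by (rule linear_sum[OF bounded_linear.linear[OF bounded_linear_T]])

lemma T_avg: "T i (coeff_avg_vec l n X) = coeff_avg_vec l n (\<lambda>\<mu>. T i (X \<mu>))"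
  by (simp only: coeff_avg_vec_def T_scaleC T_sum)

lemma eq_if_eq_on_hom:
  assumes "bounded_linear \<phi>" "bounded_linear \<psi>"
    and "\<And>c f. \<phi> (c *\<^sub>C f) = c * \<phi> f" "\<And>c f. \<psi> (c *\<^sub>C f) = (c :: complex) * \<psi> f"
    and eq: "\<And>n w. w \<in> V \<Longrightarrow> \<phi> (hom_pow n w) = \<psi> (hom_pow n w)"
  shows "\<phi> f = \<psi> (f :: 'h)"
proof -
  interpret \<phi>: bounded_linear \<phi> by fact
  interpret \<psi>: bounded_linear \<psi> by fact
  have "complex_vector.subspace {f. \<phi> f = \<psi> f}"
    by (rule complex_vector.subspaceI) (simp_all add: \<phi>.zero \<psi>.zero \<phi>.add \<psi>.add assms(3,4))
  then have "poly_span \<subseteq> {f. \<phi> f = \<psi> f}"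
    unfolding poly_span_def by (intro complex_vector.span_minimal) (auto simp: eq)
  moreover have "closed {f. \<phi> f = \<psi> f}"
    by (intro closed_Collect_eq linear_continuous_on assms(1,2))
  ultimately have "closure poly_span \<subseteq> {f. \<phi> f = \<psi> f}" by (rule closure_minimal)
  then show ?thesis by (auto simp: closure_poly_span)
qed

text \<open>
  By density take \<open>f = h\<^sub>m\<^sub>,\<^sub>v\<close>, and write \<open>T\<^sub>i f\<close> as the coefficient of \<open>cnj \<mu>\<close> in the
  function \<open>z \<mapsto> \<langle>z, v + \<mu> e\<^sub>i\<rangle>\<^sup>m\<^sup>+\<^sup>1\<close>, up to the factor \<open>m + 1\<close>.
  The inner product of that function with \<open>T\<^sub>j h\<^sub>n\<^sub>,\<^sub>w\<close> depends on \<open>\<mu>\<close> only through the \<open>j\<close>-th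
  coordinate of \<open>v + \<mu> e\<^sub>i\<close>, because \<open>w\<close> is orthogonal to \<open>e\<^sub>i\<close>: it is constant in \<open>\<mu>\<close> for \<open>j \<noteq> i\<close>, and
  its linear coefficient is \<open>\<langle>w, v\<rangle>\<^sup>n / a\<^sub>n\<^sub>+\<^sub>1\<close> for \<open>j = i\<close> and \<open>m = n\<close>.
\<close>

lemma cinner_T_T_hom:
  assumes w: "cinner w (e i) = 0"
  shows "cinner (T i f) (T j (hom_pow n w)) =
    (if i = j then a n / (Suc n * a (Suc n)) * cinner f (hom_pow n w) else 0)"
proof (rule eq_if_eq_on_hom[where f = f])
  show "bounded_linear (\<lambda>f. cinner (T i f) (T j (hom_pow n w)))"
    by (rule bounded_linear_compose[OF bounded_linear_cinner_left bounded_linear_T])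
  show "bounded_linear (\<lambda>f. if i = j then a n / (Suc n * a (Suc n)) * cinner f (hom_pow n w) else 0)"
  proof (cases "i = j")
    case True
    show ?thesis
      unfolding eqTrueI[OF True] if_True by (rule bounded_linear_const_mult[OF bounded_linear_cinner_left])
  qed (simp add: bounded_linear_zero)
  show "cinner (T i (c *\<^sub>C f)) (T j (hom_pow n w)) = c * cinner (T i f) (T j (hom_pow n w))" for c f
    by (simp only: T_scaleC cinner_scaleC_left)
  show "(if i = j then a n / (Suc n * a (Suc n)) * cinner (c *\<^sub>C f) (hom_pow n w) else 0)
      = c * (if i = j then a n / (Suc n * a (Suc n)) * cinner f (hom_pow n w) else 0)" for c f
    by (simp add: cinner_scaleC_left)
next
  fix m v
  let ?A = "if m = n then cnj (cinner v w) ^ n / a (Suc n) else 0"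
  have ew: "cinner (e i) w = 0" using w cinner_commute[of "e i" w] by simp
  have "cinner (hom_pow (Suc m) (v + \<mu> *\<^sub>C e i)) (coord_hom j n w)
      = cnj (cinner v (e j)) * ?A * cnj \<mu> ^ 0 + (if i = j then ?A else 0) * cnj \<mu> ^ 1" for \<mu>
    by (subst cinner_commute)
      (simp add: cinner_coord_hom cinner_add_left cinner_scaleC_left ew cinner_e add_divide_distrib distrib_right)
  then have "cinner (T i (hom_pow m v)) (T j (hom_pow n w)) = coeff_avg (Suc (Suc m)) 1
      (\<lambda>\<mu>. cnj (cinner v (e j)) * ?A * cnj \<mu> ^ 0 + (if i = j then ?A else 0) * cnj \<mu> ^ 1) / of_nat (Suc m)"
    unfolding T_hom coord_hom_def[of i] cinner_scaleC_left cinner_avg_left by simp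
  also have "\<dots> = (if i = j then ?A else 0) / of_nat (Suc m)"
    unfolding coeff_avg_add by (subst (1 2) coeff_avg_monomial) auto
  also have "\<dots> = (if i = j then a n / (Suc n * a (Suc n)) * cinner (hom_pow m v) (hom_pow n w) else 0)"
    using cinner_commute[of w v] by (simp add: cinner_hom)
  finally show "cinner (T i (hom_pow m v)) (T j (hom_pow n w))
      = (if i = j then a n / (Suc n * a (Suc n)) * cinner (hom_pow m v) (hom_pow n w) else 0)" .
qed

text \<open>
  In other words \<open>T\<^sub>j\<^sup>* h\<^sub>n\<^sub>,\<^sub>w = 0\<close>, because \<open>T\<^sub>j\<^sup>* h\<^sub>n\<^sub>,\<^sub>w\<close> is a multiple of \<open>cnj w\<^sub>j\<close>.
\<close>

lemma cinner_T_hom: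
  assumes w: "cinner w (e j) = 0"
  shows "cinner (T j f) (hom_pow n w) = 0"
proof -
  show ?thesis
  proof (rule eq_if_eq_on_hom[where \<phi> = "\<lambda>f. cinner (T j f) (hom_pow n w)" and \<psi> = "\<lambda>_. 0" and f = f])
    show "bounded_linear (\<lambda>f. cinner (T j f) (hom_pow n w))"
      by (rule bounded_linear_compose[OF bounded_linear_cinner_left bounded_linear_T])
    show "cinner (T j (hom_pow m v)) (hom_pow n w) = 0" for m v
      by (simp add: T_hom cinner_coord_hom w)
  qed (simp_all add: T_scaleC cinner_scaleC_left bounded_linear_zero)
qed

text \<open>
  The identity for \<open>T\<^sub>i\<^sup>* T\<^sub>i\<close> applies to \<open>T\<^sub>j h\<^sub>n\<^sub>,\<^sub>w\<close> too: it is an average of functions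
  \<open>h\<^sub>n\<^sub>+\<^sub>1\<^sub>,\<^sub>v\<close> with \<open>v = w + \<mu> e\<^sub>j\<close>, and such \<open>v\<close> remain orthogonal to \<open>e\<^sub>i\<close>.
\<close>

lemma cinner_T_T_T_T_hom:
  assumes w: "cinner w (e i) = 0" "cinner w (e j) = 0" and "i \<noteq> j"
  shows "cinner (T i (T j f)) (T i (T j (hom_pow n w))) =
    complex_of_real ((a n / (Suc n * a (Suc n))) * (a (Suc n) / (Suc (Suc n) * a (Suc (Suc n))))) *
    cinner f (hom_pow n w)"
proof -
  define c where "c n = complex_of_real (a n / (Suc n * a (Suc n)))" for n
  have wi: "cinner (w + \<mu> *\<^sub>C e j) (e i) = 0" for \<mu>
    using assms by (simp add: cinner_add_left cinner_scaleC_left cinner_e)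
  have "cinner (T i y) (T i (hom_pow (Suc n) (w + \<mu> *\<^sub>C e j)))
      = c (Suc n) * cinner y (hom_pow (Suc n) (w + \<mu> *\<^sub>C e j))" for y \<mu>
    unfolding cinner_T_T_hom[OF wi] c_def by simp
  from arg_cong[OF this, of cnj]
  have adj: "cinner (T i (hom_pow (Suc n) (w + \<mu> *\<^sub>C e j))) (T i y)
      = c (Suc n) * cinner (hom_pow (Suc n) (w + \<mu> *\<^sub>C e j)) y" for y \<mu>
    unfolding complex_cnj_mult cinner_commute[symmetric] by (simp add: c_def)
  have "cinner (T i (coord_hom j n w)) (T i y) = c (Suc n) * cinner (coord_hom j n w) y" for y
    unfolding coord_hom_def T_scaleC T_avg cinner_scaleC_left cinner_avg_left adj coeff_avg_mult_left
    by (rule mult.left_commute)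
  from arg_cong[OF this, of cnj]
  have "cinner (T i y) (T i (coord_hom j n w)) = c (Suc n) * cinner y (coord_hom j n w)" for y
    unfolding complex_cnj_mult cinner_commute[symmetric] by (simp add: c_def)
  then have "cinner (T i (T j f)) (T i (T j (hom_pow n w))) = c (Suc n) * cinner (T j f) (T j (hom_pow n w))"
    unfolding T_hom .
  also have "cinner (T j f) (T j (hom_pow n w)) = c n * cinner f (hom_pow n w)"
    unfolding cinner_T_T_hom[OF w(2)] c_def by simp
  finally show ?thesis unfolding c_def of_real_mult by (simp only: mult_ac)
qed

lemma eventually_cinner_T_T_zero:
  assumes "p \<in> poly_span"
  shows "\<forall>\<^sub>F i in sequentially. \<forall>j f. j \<noteq> i \<longrightarrow> cinner (T i f) (T j p) = 0"
  using assms unfolding poly_span_def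
proof (induction rule: complex_vector.span_induct_alt)
  case base
  have "T j 0 = 0" for j by (rule linear_0[OF bounded_linear.linear[OF bounded_linear_T]])
  then show ?case by simp
next
  case (step c x y)
  then obtain n w where x: "x = hom_pow n w" and w: "w \<in> V" by blast
  have "\<forall>\<^sub>F i in sequentially. cinner w (e i) = 0"
    using finite_support[OF w] unfolding eventually_sequentially by blast
  with step(2) show ?case
    by eventually_elim (simp add: T_add T_scaleC cinner_add_right cinner_scaleC_right x cinner_T_T_hom)
qed

lemma eventually_cinner_T_zero:
  assumes "p \<in> poly_span"
  shows "\<forall>\<^sub>F j in sequentially. \<forall>f. cinner (T j f) p = 0"
  using assms unfolding poly_span_def
proof (induction rule: complex_vector.span_induct_alt)
  case base
  show ?case by simp
next
  case (step c x y)
  then obtain n w where x: "x = hom_pow n w" and w: "w \<in> V" by blast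
  have "\<forall>\<^sub>F j in sequentially. cinner w (e j) = 0"
    using finite_support[OF w] unfolding eventually_sequentially by blast
  with step(2) show ?case
    by eventually_elim (simp add: cinner_add_right cinner_scaleC_right x cinner_T_hom)
qed

lemma poly_span_approx:
  assumes "\<epsilon> > 0"
  obtains p where "p \<in> poly_span" "norm (f - p) < \<epsilon>"
proof -
  have "f \<in> closure poly_span" by (simp add: closure_poly_span)
  then obtain p where "p \<in> poly_span" "dist p f < \<epsilon>"
    using assms unfolding closure_approachable by blast
  then show thesis using that by (simp add: dist_norm norm_minus_commute)
qed

section \<open>Submodules of vector-valued functions\<close>

abbreviation R :: "nat \<Rightarrow> 'h ^ 'n \<Rightarrow> 'h ^ 'n" where
  "R i \<equiv> tensor_id (T i)"

lemma R_component: "R i F $ k = T i (F $ k)"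
  by (simp add: tensor_id_def)

lemma R_add: "R i (F + G) = R i F + R i G"
  by (simp add: vec_eq_iff R_component T_add)

lemma R_scaleC: "R i (c *\<^sub>C F) = c *\<^sub>C R i F"
  by (simp add: vec_eq_iff R_component T_scaleC scaleC_vec_def)

lemma norm_R_le: "norm (R i F) \<le> sqrt C * norm F"
proof -
  have "(norm (R i F))\<^sup>2 \<le> (sqrt C * norm F)\<^sup>2"
  proof -
    have "(norm (R i F))\<^sup>2 = (\<Sum>k\<in>UNIV. (norm (T i (F $ k)))\<^sup>2)"
      by (simp add: norm_vec_def L2_set_def R_component sum_nonneg)
    also have "\<dots> \<le> (\<Sum>k\<in>UNIV. (sqrt C * norm (F $ k))\<^sup>2)"
      by (intro sum_mono power_mono norm_T_le) simp
    also have "\<dots> = (sqrt C * norm F)\<^sup>2"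
      by (simp add: norm_vec_def L2_set_def sum_nonneg power_mult_distrib sum_distrib_left)
    finally show ?thesis .
  qed
  then show ?thesis by (rule power2_le_imp_le) (use C_pos in simp)
qed

lemma bounded_linear_R: "bounded_linear (R i)"
proof (rule bounded_linear_intro[of _ "sqrt C"])
  show "norm (R i F) \<le> norm F * sqrt C" for F :: "'h ^ 'n"
    using norm_R_le[of i F] by (simp only: mult.commute)
qed (simp_all only: R_add R_scaleC scaleR_conv_scaleC)

text \<open>
  The vectors \<open>T\<^sub>j f\<close> are bounded in \<open>j\<close>, and eventually orthogonal to any given element of the
  dense subspace \<open>poly_span\<close>.
\<close>

lemma weakly_null:
  fixes F G :: "'h ^ 'n"
  shows "(\<lambda>j. cinner (R j F) G) \<longlonglongrightarrow> 0"
proof -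
  have "(\<lambda>j. cinner (T j f) g) \<longlonglongrightarrow> 0" for f g
  proof (rule LIMSEQ_I)
    fix \<epsilon> :: real assume "\<epsilon> > 0"
    define D where "D = sqrt C * norm f + 1"
    have D: "D > 0" unfolding D_def using C_pos by (simp add: add_nonneg_pos)
    obtain p where p: "p \<in> poly_span" "norm (g - p) < \<epsilon> / D"
      using poly_span_approx[of "\<epsilon> / D"] D \<open>\<epsilon> > 0\<close> by auto
    obtain N where N: "\<And>j. j \<ge> N \<Longrightarrow> cinner (T j f) p = 0"
      using eventually_cinner_T_zero[OF p(1)] unfolding eventually_sequentially by blast
    have "cmod (cinner (T j f) g) < \<epsilon>" if "j \<ge> N" for j
    proof -
      have "cinner (T j f) g = cinner (T j f) (g - p)"
        using N[OF that] by (simp add: cinner_diff_right)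
      then have "cmod (cinner (T j f) g) \<le> norm (T j f) * norm (g - p)"
        using norm_cinner_le[of "T j f" "g - p"] by simp
      also have "\<dots> \<le> D * norm (g - p)"
        using norm_T_le[of j f] by (intro mult_right_mono) (auto simp: D_def)
      also have "\<dots> < \<epsilon>" using p(2) D by (simp add: pos_less_divide_eq mult.commute)
      finally show ?thesis .
    qed
    then show "\<exists>N. \<forall>j\<ge>N. norm (cinner (T j f) g - 0) < \<epsilon>" by auto
  qed
  then have "(\<lambda>j. \<Sum>k\<in>UNIV. cinner (T j (F $ k)) (G $ k)) \<longlonglongrightarrow> (\<Sum>k\<in>(UNIV :: 'n set). 0)"
    by (intro tendsto_sum)
  then show ?thesis by (simp add: cinner_vec_def R_component)
qed

text \<open>
  For \<open>p\<close> in \<open>poly_span\<close> and \<open>i\<close> large, \<open>T\<^sub>j p\<close> is exactly orthogonal to the range of \<open>T\<^sub>i\<close>, whatever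
  \<open>j \<noteq> i\<close> is.  Replacing a component of \<open>F\<close> by such a \<open>p\<close> costs at most \<open>C\<close> times the distance, uniformly in \<open>i\<close> and \<open>j\<close>.
\<close>

lemma R_R_nearly_orthogonal:
  fixes F :: "'h ^ 'n"
  assumes "\<epsilon> > 0"
  shows "\<forall>\<^sub>F i in sequentially. \<forall>j X. j \<noteq> i \<longrightarrow> cmod (cinner (R i X) (R j F)) \<le> \<epsilon> * norm X"
proof -
  have scalar: "\<forall>\<^sub>F i in sequentially. \<forall>j x. j \<noteq> i \<longrightarrow> cmod (cinner (T i x) (T j f)) \<le> \<epsilon> / CARD('n) * norm x" for f
  proof -
    define d where "d = \<epsilon> / CARD('n) / C"
    have "d > 0" using assms C_pos by (simp add: d_def)
    then obtain p where p: "p \<in> poly_span" "norm (f - p) < d" by (rule poly_span_approx)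
    from eventually_cinner_T_T_zero[OF p(1)] show ?thesis
    proof eventually_elim
      case (elim i)
      show ?case
      proof (intro allI impI)
        fix j x assume "j \<noteq> i"
        have "T j f = T j p + T j (f - p)" by (simp flip: T_add)
        then have "cinner (T i x) (T j f) = cinner (T i x) (T j (f - p))"
          using elim \<open>j \<noteq> i\<close> by (simp add: cinner_add_right)
        then have "cmod (cinner (T i x) (T j f)) \<le> norm (T i x) * norm (T j (f - p))"
          using norm_cinner_le[of "T i x"] by simp
        also have "\<dots> \<le> (sqrt C * norm x) * (sqrt C * norm (f - p))"
          using C_pos by (intro mult_mono norm_T_le) auto
        also have "\<dots> = C * norm (f - p) * norm x"
          using C_pos by (simp add: mult_ac flip: mult.assoc[of "sqrt C" "sqrt C"])
        also have "\<dots> \<le> (C * d) * norm x"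
          using p(2) C_pos by (intro mult_right_mono mult_left_mono) auto
        also have "C * d = \<epsilon> / CARD('n)" using C_pos by (simp add: d_def)
        finally show "cmod (cinner (T i x) (T j f)) \<le> \<epsilon> / CARD('n) * norm x" .
      qed
    qed
  qed
  then have "\<forall>\<^sub>F i in sequentially. \<forall>k\<in>UNIV. \<forall>j x. j \<noteq> i \<longrightarrow>
      cmod (cinner (T i x) (T j (F $ k))) \<le> \<epsilon> / CARD('n) * norm x"
    by (intro eventually_ball_finite) auto
  then show ?thesis
  proof eventually_elim
    case (elim i)
    show ?case
    proof (intro allI impI)
      fix j and X :: "'h ^ 'n" assume "j \<noteq> i"
      have "cmod (cinner (R i X) (R j F)) \<le> (\<Sum>k\<in>(UNIV :: 'n set). \<epsilon> / CARD('n) * norm X)"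
        unfolding cinner_vec_def R_component
      proof (rule sum_norm_le)
        fix k
        have "cmod (cinner (T i (X $ k)) (T j (F $ k))) \<le> \<epsilon> / CARD('n) * norm (X $ k)"
          using elim \<open>j \<noteq> i\<close> by simp
        also have "\<dots> \<le> \<epsilon> / CARD('n) * norm X"
          using assms by (intro mult_left_mono Finite_Cartesian_Product.norm_nth_le) simp
        finally show "cmod (cinner (T i (X $ k)) (T j (F $ k))) \<le> \<epsilon> / CARD('n) * norm X" .
      qed
      then show "cmod (cinner (R i X) (R j F)) \<le> \<epsilon> * norm X" by simp
    qed
  qed
qed

text \<open>
  Testing against \<open>T\<^sub>i T\<^sub>j h\<close> with \<open>h = h\<^sub>n\<^sub>,\<^sub>w\<close> not orthogonal to a component of \<open>F\<close>; the norm of the test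
  vector is at most \<open>C \<parallel>h\<parallel>\<close>.
\<close>

lemma R_R_bounded_below:
  fixes F :: "'h ^ 'n"
  assumes "F \<noteq> 0"
  obtains \<delta> where "\<delta> > 0"
    "\<forall>\<^sub>F i in sequentially. \<forall>\<^sub>F j in sequentially. \<delta> \<le> norm (R i (R j F))"
proof -
  obtain k where k: "F $ k \<noteq> 0" using assms by (auto simp: vec_eq_iff)
  obtain n w where w: "w \<in> V" and nz: "cinner (F $ k) (hom_pow n w) \<noteq> 0"
  proof (rule ccontr)
    assume "\<not> thesis"
    with that have "\<And>n w. w \<in> V \<Longrightarrow> cinner (F $ k) (hom_pow n w) = 0" by blast
    then have *: "cinner (hom_pow n w) (F $ k) = 0" if "w \<in> V" for n w
      using that by (subst cinner_commute) simp
    have "cinner (F $ k) (F $ k) = 0"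
      by (rule eq_if_eq_on_hom[where \<phi> = "\<lambda>f. cinner f (F $ k)" and \<psi> = "\<lambda>_. 0" and f = "F $ k"])
         (simp_all add: * bounded_linear_cinner_left bounded_linear_zero cinner_scaleC_left)
    with k show False by (simp add: cinner_self)
  qed
  define h where "h = hom_pow n w"
  define b where "b = (a n / (Suc n * a (Suc n))) * (a (Suc n) / (Suc (Suc n) * a (Suc (Suc n))))"
  have b: "b > 0" unfolding b_def by (intro mult_pos_pos divide_pos_pos a_pos) auto
  define c where "c = b * cmod (cinner (F $ k) h)"
  have c: "c > 0" using nz b by (simp add: c_def h_def)
  have h: "h \<noteq> 0" using nz by (auto simp: h_def)
  define \<delta> where "\<delta> = c / (C * norm h)"
  have \<delta>: "\<delta> > 0" using c h C_pos by (simp add: \<delta>_def)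
  have le: "\<delta> \<le> norm (R i (R j F))" if "cinner w (e i) = 0" "cinner w (e j) = 0" "i \<noteq> j" for i j
  proof -
    have "c = cmod (cinner (T i (T j (F $ k))) (T i (T j h)))"
      unfolding h_def cinner_T_T_T_T_hom[OF that] b_def[symmetric] norm_mult norm_of_real c_def
      using b by simp
    also have "\<dots> \<le> norm (T i (T j (F $ k))) * norm (T i (T j h))" by (rule norm_cinner_le)
    also have "\<dots> \<le> norm (T i (T j (F $ k))) * (C * norm h)"
    proof (rule mult_left_mono)
      have "norm (T i (T j h)) \<le> sqrt C * norm (T j h)" by (rule norm_T_le)
      also have "\<dots> \<le> sqrt C * (sqrt C * norm h)" using C_pos by (intro mult_left_mono norm_T_le) simp
      finally show "norm (T i (T j h)) \<le> C * norm h" using C_pos by (simp flip: mult.assoc)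
    qed simp
    finally have "\<delta> \<le> norm (T i (T j (F $ k)))"
      using h C_pos by (simp add: \<delta>_def pos_divide_le_eq)
    also have "\<dots> = norm (R i (R j F) $ k)" by (simp add: R_component)
    also have "\<dots> \<le> norm (R i (R j F))" by (rule Finite_Cartesian_Product.norm_nth_le)
    finally show ?thesis .
  qed
  have supp: "\<forall>\<^sub>F i in sequentially. cinner w (e i) = 0"
    using finite_support[OF w] unfolding eventually_sequentially by blast
  then have "\<forall>\<^sub>F i in sequentially. \<forall>\<^sub>F j in sequentially. \<delta> \<le> norm (R i (R j F))"
  proof eventually_elim
    case (elim i)
    from supp eventually_gt_at_top[of i] show ?case
      by eventually_elim (use elim le in auto)
  qed
  with \<delta> that show thesis by blast
qed

text \<open>
  The index \<open>i\<close> is fixed first, far enough out for both estimates; then \<open>j\<close> tends to infinity.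
\<close>

lemma not_essentially_normal:
  fixes M :: "('h ^ 'n::finite) set"
  assumes M: "is_submodule e ev M" "M \<noteq> {0}"
  shows "\<not> essentially_normal e ev M"
proof
  assume ess: "essentially_normal e ev M"
  have sub: "complex_vector.subspace M" "closed M"
    and inv: "\<And>i F. F \<in> M \<Longrightarrow> R i F \<in> M"
    using M(1) coord_polynomials.coord[of e] unfolding is_submodule_def by blast+
  obtain F where F: "F \<in> M" "F \<noteq> 0"
    using M(2) complex_vector.subspace_0[OF sub(1)] by blast
  obtain \<delta> where \<delta>: "\<delta> > 0"
      "\<forall>\<^sub>F i in sequentially. \<forall>\<^sub>F j in sequentially. \<delta> \<le> norm (R i (R j F))"
    by (rule R_R_bounded_below[OF F(2)])
  have "\<forall>\<^sub>F i in sequentially. (\<forall>j X. j \<noteq> i \<longrightarrow> cmod (cinner (R i X) (R j F)) \<le> \<delta> / 2 * norm X) \<and>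
      (\<forall>\<^sub>F j in sequentially. \<delta> \<le> norm (R i (R j F)))"
    using \<delta>(1) by (intro eventually_conj \<delta>(2) R_R_nearly_orthogonal) simp
  then obtain i where i: "\<And>j X. j \<noteq> i \<Longrightarrow> cmod (cinner (R i X) (R j F)) \<le> \<delta> / 2 * norm X"
      "\<forall>\<^sub>F j in sequentially. \<delta> \<le> norm (R i (R j F))"
    unfolding eventually_sequentially by blast
  define Rs where "Rs = adjoint_on M (R i)"
  define A where "A F = R i (Rs F) - Rs (R i F)" for F
  have Rs: "Rs y \<in> M" "\<And>x. x \<in> M \<Longrightarrow> cinner (R i x) y = cinner x (Rs y)" for y
    using adjoint_on_characterization[OF sub bounded_linear_R R_scaleC] unfolding Rs_def by blast+
  define x where "x j = R j F" for j
  have xM: "x j \<in> M" for j unfolding x_def by (rule inv[OF F(1)])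
  have Ax: "cinner (A (x j)) (x j) = complex_of_real ((norm (Rs (x j)))\<^sup>2 - (norm (R i (x j)))\<^sup>2)" for j
  proof -
    have "cinner (R i (Rs (x j))) (x j) = cinner (Rs (x j)) (Rs (x j))" by (rule Rs(2)[OF Rs(1)])
    moreover have "cinner (R i (x j)) (R i (x j)) = cinner (x j) (Rs (R i (x j)))" by (rule Rs(2)[OF xM])
    then have "cinner (Rs (R i (x j))) (x j) = cinner (R i (x j)) (R i (x j))" by (metis cinner_commute)
    ultimately show ?thesis by (simp add: A_def cinner_diff_left cinner_self)
  qed
  \<comment> \<open>pairing \<open>Rs (x j)\<close> with itself is pairing \<open>x j\<close> with an element of the range of \<open>R i\<close>\<close>
  have "norm (Rs (x j)) \<le> \<delta> / 2" if "j \<noteq> i" for j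
  proof -
    have "complex_of_real ((norm (Rs (x j)))\<^sup>2) = cinner (R i (Rs (x j))) (x j)"
      unfolding Rs(2)[OF Rs(1)] cinner_self ..
    then have "(norm (Rs (x j)))\<^sup>2 = cmod (cinner (R i (Rs (x j))) (x j))"
      by (metis norm_of_real abs_of_nonneg zero_le_power2)
    also have "\<dots> \<le> \<delta> / 2 * norm (Rs (x j))" unfolding x_def by (rule i(1)[OF that])
    finally show ?thesis
      using \<delta>(1) by (cases "norm (Rs (x j)) = 0") (auto simp: power2_eq_square)
  qed
  then have "\<forall>\<^sub>F j in sequentially. norm (Rs (x j)) \<le> \<delta> / 2"
    unfolding eventually_sequentially by (intro exI[of _ "Suc i"]) simp
  with i(2) have far: "\<forall>\<^sub>F j in sequentially. cmod (cinner (A (x j)) (x j)) \<ge> \<delta>\<^sup>2 / 2"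
  proof eventually_elim
    case (elim j)
    have "\<delta>\<^sup>2 \<le> (norm (R i (x j)))\<^sup>2" using elim \<delta>(1) by (intro power_mono) (auto simp: x_def)
    moreover have "(norm (Rs (x j)))\<^sup>2 \<le> (\<delta> / 2)\<^sup>2" using elim by (intro power_mono) auto
    moreover have "(\<delta> / 2)\<^sup>2 = \<delta>\<^sup>2 / 4" by (simp add: power_divide)
    ultimately show ?case unfolding Ax norm_of_real using zero_le_power2[of \<delta>] by linarith
  qed
  have bounded: "bounded (range x)"
    unfolding bounded_iff x_def using norm_R_le by blast
  have "compact_operator_on M A"
    using ess unfolding essentially_normal_def Let_def A_def Rs_def by blast
  then have "compact (closure (A ` range x))"
    using bounded xM unfolding compact_operator_on_def by blast
  then obtain y r where r: "strict_mono r" "(\<lambda>j. A (x (r j))) \<longlonglongrightarrow> y"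
    using closure_subset[of "A ` range x"] unfolding compact_def by (force simp: comp_def)
  obtain B where B: "\<And>j. norm (x j) \<le> B" using bounded unfolding bounded_iff by blast
  \<comment> \<open>a strong limit of the \<open>A (x (r j))\<close> pairs to \<open>0\<close> with the weakly null bounded sequence\<close>
  have "(\<lambda>j. cinner (A (x (r j)) - y) (x (r j)) + cnj (cinner (x (r j)) y)) \<longlonglongrightarrow> 0 + cnj 0"
  proof (intro tendsto_add tendsto_cnj)
    show "(\<lambda>j. cinner (x (r j)) y) \<longlonglongrightarrow> 0"
      using LIMSEQ_subseq_LIMSEQ[OF weakly_null[of F y] r(1)] by (simp add: comp_def x_def)
    show "(\<lambda>j. cinner (A (x (r j)) - y) (x (r j))) \<longlonglongrightarrow> 0"
    proof (rule Lim_null_comparison)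
      show "(\<lambda>j. norm (A (x (r j)) - y) * B) \<longlonglongrightarrow> 0"
        using r(2) by (intro tendsto_mult_left_zero tendsto_norm_zero) (simp add: Lim_null[symmetric])
      show "\<forall>\<^sub>F j in sequentially. norm (cinner (A (x (r j)) - y) (x (r j))) \<le> norm (A (x (r j)) - y) * B"
        by (intro always_eventually allI order_trans[OF norm_cinner_le] mult_left_mono B) simp
    qed
  qed
  then have "(\<lambda>j. cinner (A (x (r j))) (x (r j))) \<longlonglongrightarrow> 0"
    by (simp add: cinner_diff_left cinner_commute[of y, symmetric])
  from tendsto_norm[OF this] have "(\<lambda>j. cmod (cinner (A (x (r j))) (x (r j)))) \<longlonglongrightarrow> 0" by simp
  moreover have "\<forall>\<^sub>F j in sequentially. \<delta>\<^sup>2 / 2 \<le> cmod (cinner (A (x (r j))) (x (r j)))"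
    using eventually_subseq[OF r(1) far] .
  ultimately have "\<delta>\<^sup>2 / 2 \<le> 0"
    by (intro tendsto_lowerbound) auto
  with \<delta>(1) show False by (simp add: not_le)
qed

end

theorem theorem6p1:
  fixes e :: "nat \<Rightarrow> 'e::complex_hilbert"
    and K :: "'e \<Rightarrow> 'e \<Rightarrow> complex"
    and ev :: "'h::complex_hilbert \<Rightarrow> 'e \<Rightarrow> complex"
    and M :: "('h ^ 'n::finite) set"
  assumes "orthonormal_basis e"
    and "regular_unitarily_invariant_kernel K"
    and "is_rkhs (ball 0 1) K ev"
    and "is_submodule e ev M"
    and "M \<noteq> {0}"
  shows "\<not> essentially_normal e ev M"
proof -
  from assms(2) obtain a :: "nat \<Rightarrow> real" where a: "a 0 = 1" "\<forall>n\<ge>1. a n > 0"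
    and K: "\<forall>z\<in>ball 0 1. \<forall>w\<in>ball 0 1. (\<lambda>n. complex_of_real (a n) * cinner z w ^ n) sums K z w"
    and lim: "(\<lambda>n. a n / a (Suc n)) \<longlonglongrightarrow> 1"
    unfolding regular_unitarily_invariant_kernel_def by blast
  have pos: "a n > 0" for n using a by (cases n) auto
  have "Bseq (\<lambda>n. a n / a (Suc n))" using lim by (intro convergent_imp_Bseq convergentI)
  then obtain C where C: "\<forall>n. norm (a n / a (Suc n)) \<le> C" by (rule BseqE)
  have "a n \<le> C * a (Suc n)" for n
    using C[rule_format, of n] pos[of n] pos[of "Suc n"] by (simp add: pos_divide_le_eq)
  then interpret coordinate_rkhs a K ev e C
    using pos K assms(1,3) by unfold_locales auto
  show ?thesis using assms(4,5) by (rule not_essentially_normal)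
qed

end
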